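(* Let $q_1,q_2,\dots$ be independent indeterminates over $\mathbb Q$. The difference Burchnall-Chaundy equation $$Q_{n+1}(z+1)Q_{n-1}(z)-Q_{n+1}(z)Q_{n-1}(z+1)=Q_n(z)Q_n(z+1),\qquad n\ge0,$$ with $Q_{-1}(z)=Q_0(z)=1$ and initial data $Q_k(0)=q_k$ for $k\ge1$, has a solution consisting of polynomials $Q_n(z)$ in $z$ with coefficients in $\mathbb Q(q_1,q_2,\dots)$, and for every $n\ge1$ these polynomials satisfy $$A_n\,Q_n(z)\in\mathbb Z[z;\,q_1^{\pm1},\dots,q_{n-2}^{\pm1},q_{n-1},q_n],\qquad A_n=\prod_{j=1}^n(2j-1)!! .$$
   Context: Here $(2k+1)!!=1\cdot3\cdot5\cdots(2k+1)$. The shift $z\mapsto z+1$ keeps all $q_k$ fixed. For $n=1,2$ no variable is inverted: the ring is $\mathbb Z[z;q_1]$, respectively $\mathbb Z[z;q_1,q_2]$. *)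

theory Defs
  imports
    "HOL-Library.Poly_Mapping"
    "HOL-Computational_Algebra.Polynomial"
    "HOL-Computational_Algebra.Fraction_Field"
begin

(* The field of rational functions over the rationals in countably many indeterminates:
   an inner nat =>0 nat is an exponent vector (a monomial), an outer finitely supported
   function assigns rational coefficients to monomials. *)
type_synonym rat_funs = "((nat \<Rightarrow>\<^sub>0 nat) \<Rightarrow>\<^sub>0 rat) fract"

(* The indeterminates are numbered q_1, q_2, ..., so q_k sits at variable index k - 1
   and the field has no further indeterminates.  The value at k = 0 is meaningless. *)
definition indet :: "nat \<Rightarrow> rat_funs" where
  "indet k = Fract (Poly_Mapping.single (Poly_Mapping.single (k - 1) 1) 1) 1"

(* p(z) |-> p(z + 1); coefficients, hence all q_k, stay fixed. *)
definition shift :: "'a::comm_ring_1 poly \<Rightarrow> 'a poly" where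
  "shift p = pcompose p [:1, 1:]"

(* The unital subring generated by S, i.e. Z[S]; 0 and negatives arise through diff. *)
inductive_set subring_gen :: "'a::comm_ring_1 set \<Rightarrow> 'a set" for S where
  gen: "s \<in> S \<Longrightarrow> s \<in> subring_gen S"
| one: "1 \<in> subring_gen S"
| diff: "a \<in> subring_gen S \<Longrightarrow> b \<in> subring_gen S \<Longrightarrow> a - b \<in> subring_gen S"
| mult: "a \<in> subring_gen S \<Longrightarrow> b \<in> subring_gen S \<Longrightarrow> a * b \<in> subring_gen S"

(* Z[z; q_1^{+-1}, ..., q_{n-2}^{+-1}, q_{n-1}, q_n] inside Q(q_1, q_2, ...)[z].
   For n = 1, 2 the truncated subtraction makes {1..n - 2} empty: nothing is inverted. *)
definition laurent_ring :: "nat \<Rightarrow> rat_funs poly set" where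
  "laurent_ring n = subring_gen
     ({[:0, 1:]} \<union> (\<lambda>k. [:indet k:]) ` {1..n} \<union> (\<lambda>k. [:inverse (indet k):]) ` {1..n - 2})"

fun double_fact :: "nat \<Rightarrow> nat" where
  "double_fact 0 = 1"
| "double_fact (Suc 0) = 1"
| "double_fact (Suc (Suc n)) = Suc (Suc n) * double_fact n"

definition A_prod :: "nat \<Rightarrow> nat" where
  "A_prod n = (\<Prod>j = 1..n. double_fact (2 * j - 1))"

end

theory Submission
  imports
    "Jordan_Normal_Form.Determinant"
    "HOL-Computational_Algebra.Formal_Power_Series"
    "HOL-Computational_Algebra.Polynomial_Factorial"
    Defs
begin

text \<open>
  Take \<open>Q\<^sub>n\<close> to be the Schur function of the staircase partition \<open>(n, \<dots>, 1)\<close>, that is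
  \<open>det (h\<^bsub>2i-1-j\<^esub>)\<close> with \<open>1 \<le> i \<le> n\<close>, \<open>0 \<le> j < n\<close>, where \<open>\<Sum> h\<^sub>k X\<^sup>k = (1 + X)\<^sup>z V(X)\<close>.
  The shift of \<open>z\<close> multiplies the series by \<open>1 + X\<close>, which makes \<open>Q\<^sub>n\<close> a Casorati determinant,
  and Dodgson condensation gives the Burchnall-Chaundy equation.

  The determinant does not change when the series is multiplied by an even series with constant
  term 1, so one may take \<open>V = 1 + t\<^sub>0 X + t\<^sub>1 X\<^sup>3 + \<dots>\<close>. Then \<open>Q\<^sub>n(0)\<close> is linear in \<open>t\<^bsub>n-1\<^esub>\<close> with
  coefficient \<open>\<plusminus> Q\<^bsub>n-2\<^esub>(0)\<close>, so that \<open>t\<^bsub>n-1\<^esub>\<close> is an integral Laurent polynomial in the \<open>q\<^sub>k\<close> in which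
  only \<open>q\<^sub>1, \<dots>, q\<^bsub>n-2\<^esub>\<close> are inverted.

  For the denominators in \<open>z\<close>, replace \<open>(1 + X)\<^sup>z\<close> by two even multiples of it. With
  \<open>F = ((1 + X) / (1 - X))\<^sup>z\<close>, the series \<open>2F / (1 + F)\<close> has odd denominators. With
  \<open>u = F\<^bsup>1/2\<^esup>\<close>, column operations by the coefficients of \<open>u(-X) V(-X)\<close> turn the matrix into
  coefficients of \<open>(u(x) u(y) - 1) / (x + y)\<close>, up to integral factors; the differential equation
  of \<open>u\<close> and the integrality of super Catalan numbers bound their denominators by
  \<open>(2i + 1)!! (2j - 1)!!\<close> times a power of 2, and these bounds multiply up to \<open>A\<^sub>n\<close>.
\<close>

section \<open>Determinants\<close>

lemma sum_eq_single:
  assumes "finite A" "k \<in> A" "\<And>i. i \<in> A \<Longrightarrow> i \<noteq> k \<Longrightarrow> f i = 0"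
  shows "sum f A = f k"
  using assms sum.remove[of A k f] by simp

lemma det_unit_lower_triangular:
  fixes A :: "'a::comm_ring_1 mat"
  assumes A: "A \<in> carrier_mat n n"
    and "\<And>i j. i < j \<Longrightarrow> j < n \<Longrightarrow> A $$ (i, j) = 0" and "\<And>i. i < n \<Longrightarrow> A $$ (i, i) = 1"
  shows "det A = 1"
proof -
  have "diag_mat A = map (\<lambda>i. 1) [0..<n]"
    using A assms(3) by (auto simp: diag_mat_def)
  then show ?thesis
    using det_lower_triangular[OF assms(2) A] by (simp add: map_replicate_const)
qed

lemma det_unit_upper_triangular:
  fixes A :: "'a::comm_ring_1 mat"
  assumes A: "A \<in> carrier_mat n n"
    and "\<And>i j. j < i \<Longrightarrow> i < n \<Longrightarrow> A $$ (i, j) = 0" and "\<And>i. i < n \<Longrightarrow> A $$ (i, i) = 1"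
  shows "det A = 1"
proof -
  have "det (transpose_mat A) = 1"
    by (rule det_unit_lower_triangular[of _ n]) (use assms in auto)
  then show ?thesis using det_transpose[OF A] by simp
qed

lemma det_first_row_unit:
  fixes A :: "'a::comm_ring_1 mat"
  assumes A: "A \<in> carrier_mat (Suc n) (Suc n)" and "A $$ (0, 0) = 1"
    and "\<And>j. 0 < j \<Longrightarrow> j \<le> n \<Longrightarrow> A $$ (0, j) = 0"
  shows "det A = det (mat_delete A 0 0)"
proof -
  have "det A = (\<Sum>j<Suc n. A $$ (0, j) * cofactor A 0 j)"
    using laplace_expansion_row[OF A, of 0] by simp
  also have "\<dots> = A $$ (0, 0) * cofactor A 0 0"
    using assms(3) by (intro sum_eq_single) auto
  finally show ?thesis using assms(2) by (simp add: cofactor_def)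
qed

text \<open>Multiply \<open>A\<close> by the identity matrix with its end columns replaced by those
  of the adjugate. The product has \<open>det A\<close> times a unit vector in each end column, so
  its determinant is \<open>det A\<close> squared times the inner minor; one \<open>det A\<close> is
  cancelled by \<open>nz\<close>.\<close>

lemma det_dodgson:
  fixes A :: "'a::idom mat"
  assumes A: "A \<in> carrier_mat (n + 2) (n + 2)" and nz: "det A \<noteq> 0"
  shows "det A * det (mat_delete (mat_delete A 0 0) n n) =
    det (mat_delete A 0 0) * det (mat_delete A (n + 1) (n + 1)) -
    det (mat_delete A 0 (n + 1)) * det (mat_delete A (n + 1) 0)"
proof -
  define B where "B = mat (n + 2) (n + 2) (\<lambda>(i, j). if j = 0 then cofactor A 0 i
     else if j = n + 1 then cofactor A (n + 1) i else if i = j then 1 else 0)"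
  have B: "B \<in> carrier_mat (n + 2) (n + 2)" by (simp add: B_def)
  have adj: "(\<Sum>k<n + 2. A $$ (i, k) * cofactor A j k) = (if i = j then det A else 0)"
    if "i < n + 2" "j < n + 2" for i j
  proof -
    have "(A * adj_mat A) $$ (i, j) = (\<Sum>k<n + 2. A $$ (i, k) * cofactor A j k)"
      using that A by (simp add: scalar_prod_def adj_mat_def atLeast0LessThan)
    then show ?thesis using adj_mat(2)[OF A] that by (cases "i = j") (simp_all del: sum.lessThan_Suc)
  qed
  define C where "C = A * B"
  have C: "C \<in> carrier_mat (n + 2) (n + 2)" using A B by (simp add: C_def)
  have Cij: "C $$ (i, j) = (if j = 0 then if i = 0 then det A else 0
      else if j = n + 1 then if i = n + 1 then det A else 0 else A $$ (i, j))"
    if "i < n + 2" "j < n + 2" for i j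
  proof -
    have "C $$ (i, j) = (\<Sum>k<n + 2. A $$ (i, k) * B $$ (k, j))"
      using that A B by (simp add: C_def scalar_prod_def atLeast0LessThan)
    also have "\<dots> = (if j = 0 then \<Sum>k<n + 2. A $$ (i, k) * cofactor A 0 k
       else if j = n + 1 then \<Sum>k<n + 2. A $$ (i, k) * cofactor A (n + 1) k
       else A $$ (i, j))"
    proof (cases "j = 0 \<or> j = n + 1")
      case False
      then have "(\<Sum>k<n + 2. A $$ (i, k) * B $$ (k, j)) = A $$ (i, j) * B $$ (j, j)"
        using that by (intro sum_eq_single) (auto simp: B_def)
      then show ?thesis using False that by (simp add: B_def)
    qed (auto simp: B_def)
    finally show ?thesis using that adj[of i 0] adj[of i "n + 1"] by (simp del: sum.lessThan_Suc)
  qed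
  have "det C = (\<Sum>i<n + 2. C $$ (i, 0) * cofactor C i 0)"
    using laplace_expansion_column[OF C, of 0] by simp
  also have "\<dots> = C $$ (0, 0) * cofactor C 0 0"
    using Cij by (intro sum_eq_single) auto
  also have "\<dots> = det A * det (mat_delete C 0 0)"
    using Cij by (simp add: cofactor_def)
  also have "det (mat_delete C 0 0) = (\<Sum>i<n + 1. mat_delete C 0 0 $$ (i, n) * cofactor (mat_delete C 0 0) i n)"
    using laplace_expansion_column[of "mat_delete C 0 0" "n + 1" n] C by (simp add: mat_delete_def)
  also have "\<dots> = mat_delete C 0 0 $$ (n, n) * cofactor (mat_delete C 0 0) n n"
    using Cij C by (intro sum_eq_single) (auto simp: mat_delete_def)
  also have "\<dots> = det A * det (mat_delete (mat_delete C 0 0) n n)"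
    using Cij C by (simp add: mat_delete_def cofactor_def power_add[symmetric] mult_2[symmetric])
  also have "mat_delete (mat_delete C 0 0) n n = mat_delete (mat_delete A 0 0) n n"
    using Cij C A by (intro eq_matI) (auto simp: mat_delete_def)
  finally have 1: "det A * det B = det A * (det A * det (mat_delete (mat_delete A 0 0) n n))"
    using det_mult[OF A B] by (simp add: C_def)
  have "det B = (\<Sum>j<n + 2. B $$ (0, j) * cofactor B 0 j)"
    using laplace_expansion_row[OF B, of 0] by simp
  also have "\<dots> = (\<Sum>j\<in>{0, n + 1}. B $$ (0, j) * cofactor B 0 j)"
    by (rule sum.mono_neutral_right) (auto simp: B_def)
  also have "\<dots> = B $$ (0, 0) * det (mat_delete B 0 0) + B $$ (0, n + 1) * (-1) ^ (n + 1) * det (mat_delete B 0 (n + 1))"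
    by (simp add: cofactor_def)
  also have "det (mat_delete B 0 0) = B $$ (n + 1, n + 1)"
  proof -
    let ?D = "mat_delete B 0 0"
    have D: "?D \<in> carrier_mat (n + 1) (n + 1)" by (simp add: mat_delete_def B_def)
    have "det ?D = (\<Sum>j<n + 1. ?D $$ (n, j) * cofactor ?D n j)"
      using laplace_expansion_row[OF D, of n] by simp
    also have "\<dots> = ?D $$ (n, n) * cofactor ?D n n"
      by (intro sum_eq_single) (auto simp: mat_delete_def B_def)
    also have "det (mat_delete ?D n n) = 1"
      by (rule det_unit_lower_triangular[of _ n]) (auto simp: mat_delete_def B_def)
    then have "?D $$ (n, n) * cofactor ?D n n = B $$ (n + 1, n + 1)"
      by (simp add: cofactor_def mat_delete_def B_def power_add[symmetric] mult_2[symmetric])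
    finally show ?thesis .
  qed
  also have "det (mat_delete B 0 (n + 1)) = (-1) ^ n * B $$ (n + 1, 0)"
  proof -
    let ?D = "mat_delete B 0 (n + 1)"
    have D: "?D \<in> carrier_mat (n + 1) (n + 1)" by (simp add: mat_delete_def B_def)
    have "det ?D = (\<Sum>j<n + 1. ?D $$ (n, j) * cofactor ?D n j)"
      using laplace_expansion_row[OF D, of n] by simp
    also have "\<dots> = ?D $$ (n, 0) * cofactor ?D n 0"
      by (intro sum_eq_single) (auto simp: mat_delete_def B_def)
    also have "det (mat_delete ?D n 0) = 1"
      by (rule det_unit_lower_triangular[of _ n]) (auto simp: mat_delete_def B_def)
    then have "?D $$ (n, 0) * cofactor ?D n 0 = (-1) ^ n * B $$ (n + 1, 0)"
      by (simp add: cofactor_def mat_delete_def B_def)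
    finally show ?thesis .
  qed
  finally have "det B = cofactor A 0 0 * cofactor A (n + 1) (n + 1) - cofactor A (n + 1) 0 * cofactor A 0 (n + 1)"
    by (simp add: B_def mult.assoc[symmetric] power_add[symmetric] mult_2[symmetric])
  also have "\<dots> = det (mat_delete A 0 0) * det (mat_delete A (n + 1) (n + 1)) -
    det (mat_delete A 0 (n + 1)) * det (mat_delete A (n + 1) 0)"
    by (simp add: cofactor_def mult_ac power_add[symmetric] mult_2[symmetric])
  finally show ?thesis using 1 nz by simp
qed

lemma det_scale:
  fixes A :: "'a::comm_ring_1 mat"
  assumes "A \<in> carrier_mat n n"
  shows "det (mat n n (\<lambda>(i, j). r i * A $$ (i, j) * c j)) = (\<Prod>i<n. r i) * det A * (\<Prod>j<n. c j)"
proof -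
  have *: "(\<Prod>i<n. r i * A $$ (i, p i) * c (p i)) = (\<Prod>i<n. r i) * (\<Prod>i<n. A $$ (i, p i)) * (\<Prod>j<n. c j)"
    if "p permutes {0..<n}" for p
    using prod.permute[OF that, of c] by (simp add: prod.distrib atLeast0LessThan o_def)
  have "det (mat n n (\<lambda>(i, j). r i * A $$ (i, j) * c j)) =
      (\<Sum>p | p permutes {0..<n}. signof p * (\<Prod>i<n. r i * A $$ (i, p i) * c (p i)))"
    using permutes_in_image
    by (subst det_def'[of _ n]) (auto simp: atLeast0LessThan intro!: sum.cong prod.cong)
  also have "\<dots> = (\<Sum>p | p permutes {0..<n}. (\<Prod>i<n. r i) * (signof p * (\<Prod>i<n. A $$ (i, p i))) * (\<Prod>j<n. c j))"
  proof (rule sum.cong)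
    fix p assume "p \<in> {p. p permutes {0..<n}}"
    then have "(\<Prod>i<n. r i * A $$ (i, p i) * c (p i)) =
        (\<Prod>i<n. r i) * (\<Prod>i<n. A $$ (i, p i)) * (\<Prod>j<n. c j)"
      using * by blast
    then show "signof p * (\<Prod>i<n. r i * A $$ (i, p i) * c (p i)) =
        (\<Prod>i<n. r i) * (signof p * (\<Prod>i<n. A $$ (i, p i))) * (\<Prod>j<n. c j)"
      by (simp only: mult_ac)
  qed simp
  finally show ?thesis
    by (simp add: det_def'[OF assms] atLeast0LessThan sum_distrib_left sum_distrib_right)
qed

section \<open>Staircase Schur functions and the Burchnall-Chaundy equation\<close>

text \<open>The entry is h_(2i+1-j). As a coefficient of \<open>fps_X ^ j * H\<close> it is 0 for a
  negative index, and a change of basis among the powers of X becomes a column operation.\<close>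

definition odd_mat :: "nat \<Rightarrow> 'a::comm_ring_1 fps \<Rightarrow> 'a mat" where
  "odd_mat n H = mat n n (\<lambda>(i, j). fps_nth (fps_X ^ j * H) (2 * i + 1))"

text \<open>This is the Jacobi-Trudi determinant of the partition \<open>(n, \<dots>, 1)\<close>, with rows and
  columns reversed and the coefficients of \<open>H\<close> as complete symmetric functions.\<close>

definition stair :: "nat \<Rightarrow> 'a::comm_ring_1 fps \<Rightarrow> 'a" where
  "stair n H = det (odd_mat n H)"

lemma odd_mat_carrier [simp]: "odd_mat n H \<in> carrier_mat n n"
  by (simp add: odd_mat_def)

lemma odd_mat_index [simp]:
  "i < n \<Longrightarrow> j < n \<Longrightarrow> odd_mat n H $$ (i, j) = fps_nth (fps_X ^ j * H) (2 * i + 1)"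
  by (simp add: odd_mat_def)

lemma stair_0 [simp]: "stair 0 H = 1"
  by (simp add: stair_def)

lemma stair_cong:
  assumes "\<And>k. k < 2 * n \<Longrightarrow> fps_nth H k = fps_nth H' k"
  shows "stair n H = stair n H'"
proof -
  have "odd_mat n H = odd_mat n H'"
    using assms by (intro eq_matI) (auto simp: odd_mat_def fps_X_power_mult_nth)
  then show ?thesis by (simp add: stair_def)
qed

text \<open>The rows read odd coefficients only, so an even factor combines row \<open>i\<close>
  with earlier rows through the unipotent matrix \<open>L\<close>.\<close>

lemma stair_even_mult:
  assumes odd0: "\<And>k. odd k \<Longrightarrow> fps_nth E k = 0" and E0: "fps_nth E 0 = 1"
  shows "stair n (E * H) = stair n H"
proof -
  define L where "L = mat n n (\<lambda>(i, k). if k \<le> i then fps_nth E (2 * (i - k)) else 0)"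
  have L: "L \<in> carrier_mat n n" by (simp add: L_def)
  have "odd_mat n (E * H) = L * odd_mat n H"
  proof (rule eq_matI)
    fix i j assume "i < dim_row (L * odd_mat n H)" "j < dim_col (L * odd_mat n H)"
    then have ij: "i < n" "j < n" by (simp_all add: L_def odd_mat_def)
    define G where "G = fps_X ^ j * H"
    have "odd_mat n (E * H) $$ (i, j) = fps_nth (E * G) (2 * i + 1)"
      using ij by (simp add: G_def mult_ac)
    also have "\<dots> = (\<Sum>k=0..2 * i + 1. fps_nth E k * fps_nth G (2 * i + 1 - k))"
      by (simp add: fps_mult_nth)
    also have "\<dots> = (\<Sum>k\<in>(\<lambda>m. 2 * (i - m)) ` {..i}. fps_nth E k * fps_nth G (2 * i + 1 - k))"
    proof (rule sum.mono_neutral_right)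
      show "\<forall>k\<in>{0..2 * i + 1} - (\<lambda>m. 2 * (i - m)) ` {..i}. fps_nth E k * fps_nth G (2 * i + 1 - k) = 0"
      proof
        fix k assume k: "k \<in> {0..2 * i + 1} - (\<lambda>m. 2 * (i - m)) ` {..i}"
        have "odd k"
        proof
          assume "even k"
          then obtain m where "k = 2 * m" by blast
          then have "k = 2 * (i - (i - m))" "i - m \<in> {..i}" using k by auto
          then show False using k by blast
        qed
        then show "fps_nth E k * fps_nth G (2 * i + 1 - k) = 0" by (simp add: odd0)
      qed
    qed auto
    also have "\<dots> = (\<Sum>m\<le>i. fps_nth E (2 * (i - m)) * fps_nth G (2 * m + 1))"
    proof (subst sum.reindex)
      have "2 * i + 1 - 2 * (i - m) = 2 * m + 1" if "m \<le> i" for m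
        using that by simp
      then show "sum ((\<lambda>k. fps_nth E k * fps_nth G (2 * i + 1 - k)) \<circ> (\<lambda>m. 2 * (i - m))) {..i} =
          (\<Sum>m\<le>i. fps_nth E (2 * (i - m)) * fps_nth G (2 * m + 1))"
        by (intro sum.cong) (simp_all only: o_def atMost_iff)
    qed (auto simp: inj_on_def)
    also have "\<dots> = (\<Sum>m<n. L $$ (i, m) * odd_mat n H $$ (m, j))"
      using ij by (intro sum.mono_neutral_cong_left) (auto simp: L_def G_def)
    finally show "odd_mat n (E * H) $$ (i, j) = (L * odd_mat n H) $$ (i, j)"
      using ij carrier_matD[OF L] carrier_matD[OF odd_mat_carrier[of n H]]
      by (simp add: scalar_prod_def atLeast0LessThan)
  qed (auto simp: L_def odd_mat_def)
  moreover have "det L = 1"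
    by (rule det_unit_lower_triangular[OF L]) (simp_all add: L_def E0)
  ultimately show ?thesis
    using det_mult[OF L, of "odd_mat n H"] by (simp add: stair_def)
qed

section \<open>Binomial column operations and Casorati determinants\<close>

lemma fps_nth_one_plus_X_power_mult:
  fixes H :: "'a::comm_ring_1 fps"
  assumes "j < n"
  shows "fps_nth ((1 + fps_X) ^ j * H) k = (\<Sum>l<n. fps_nth (fps_X ^ l * H) k * of_nat (j choose l))"
proof -
  have "(1 + fps_X) ^ j * H = (\<Sum>l\<le>j. of_nat (j choose l) * (fps_X ^ l * H))"
    using binomial_ring[of fps_X "1 :: 'a fps" j] by (simp add: sum_distrib_left add.commute[of 1] mult_ac)
  then have "fps_nth ((1 + fps_X) ^ j * H) k = (\<Sum>l\<le>j. fps_nth (of_nat (j choose l) * (fps_X ^ l * H)) k)"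
    by (simp add: fps_sum_nth)
  also have "\<dots> = (\<Sum>l\<le>j. fps_nth (fps_X ^ l * H) k * of_nat (j choose l))"
    by (simp add: fps_of_nat[symmetric] mult.commute del: fps_of_nat)
  also have "\<dots> = (\<Sum>l<n. fps_nth (fps_X ^ l * H) k * of_nat (j choose l))"
    using assms by (intro sum.mono_neutral_left) (auto simp: binomial_eq_0)
  finally show ?thesis .
qed

lemma det_binomial_columns:
  fixes W :: "'a::comm_ring_1 mat"
  assumes "W \<in> carrier_mat n n" "W' \<in> carrier_mat n n"
    and "\<And>i j. i < n \<Longrightarrow> j < n \<Longrightarrow> W' $$ (i, j) = (\<Sum>l<n. W $$ (i, l) * of_nat (j choose l))"
  shows "det W' = det W"
proof -
  define U :: "'a mat" where "U = mat n n (\<lambda>(l, j). of_nat (j choose l))"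
  have U: "U \<in> carrier_mat n n" by (simp add: U_def)
  have "W' = W * U"
    using assms by (intro eq_matI) (auto simp: scalar_prod_def atLeast0LessThan U_def)
  moreover have "det U = 1"
    by (rule det_unit_upper_triangular[OF U]) (simp_all add: U_def binomial_eq_0)
  ultimately show ?thesis using det_mult[OF assms(1) U] by simp
qed

text \<open>With \<open>f\<^sub>i(z)\<close> the coefficient of \<open>X\<^bsup>2i+1\<^esup>\<close> in \<open>(1 + X)\<^sup>z V\<close>, the entries below are the
  values \<open>f\<^sub>i(z + j)\<close>.\<close>

definition casorati :: "nat \<Rightarrow> 'a::comm_ring_1 fps \<Rightarrow> 'a mat" where
  "casorati n H = mat n n (\<lambda>(i, j). fps_nth ((1 + fps_X) ^ j * H) (2 * i + 1))"

lemma det_casorati: "det (casorati n H) = stair n H"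
  unfolding stair_def
  by (rule det_binomial_columns[of _ n]) (simp_all add: casorati_def fps_nth_one_plus_X_power_mult[of _ n])

text \<open>Casorati matrix of 1, f_0, ..., f_(n-2): the row of ones prepares the
  condensation.\<close>

definition casorati_one :: "nat \<Rightarrow> 'a::comm_ring_1 fps \<Rightarrow> 'a mat" where
  "casorati_one n H = mat n n (\<lambda>(i, j). if i = 0 then 1 else fps_nth ((1 + fps_X) ^ j * H) (2 * i - 1))"

text \<open>In the basis X^l the row of ones becomes a unit vector. Once it is removed, the row of
  coefficients of X is again a unit vector since \<open>H\<close> has constant term 1, so the size
  drops by two.\<close>

lemma det_casorati_one:
  assumes "fps_nth H 0 = 1" and "n \<ge> 1"
  shows "det (casorati_one n H) = stair (n - 2) H"
proof -
  define W where "W = mat n n (\<lambda>(i, l). if i = 0 then if l = 0 then 1 else 0 else fps_nth (fps_X ^ l * H) (2 * i - 1))"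
  obtain m where m: "n = Suc m" using assms(2) by (cases n) auto
  have W: "W \<in> carrier_mat n n" by (simp add: W_def)
  have "det (casorati_one n H) = det W"
  proof (rule det_binomial_columns[OF W])
    fix i j assume ij: "i < n" "j < n"
    have "(\<Sum>l<n. (if l = 0 then 1 else 0) * of_nat (j choose l)) = (1::'a)"
      using ij by (subst sum.mono_neutral_right[of "{..<n}" "{0}"]) auto
    with ij show "casorati_one n H $$ (i, j) = (\<Sum>l<n. W $$ (i, l) * of_nat (j choose l))"
      by (simp add: casorati_one_def W_def fps_nth_one_plus_X_power_mult[of _ n])
  qed (simp add: casorati_one_def)
  also have "det W = det (mat_delete W 0 0)"
    by (rule det_first_row_unit[of _ m]) (simp_all add: W_def m)
  also have "\<dots> = stair (n - 2) H"
  proof (cases m)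
    case 0
    then show ?thesis by (simp add: m W_def mat_delete_def)
  next
    case (Suc k)
    have "det (mat_delete W 0 0) = det (mat_delete (mat_delete W 0 0) 0 0)"
      by (rule det_first_row_unit[of _ k]) 
        (simp_all add: W_def m Suc mat_delete_def fps_X_power_mult_nth assms(1) del: power_Suc)
    also have "mat_delete (mat_delete W 0 0) 0 0 = odd_mat k H"
      by (rule eq_matI) (auto simp: W_def m Suc mat_delete_def odd_mat_def fps_X_power_mult_nth simp del: power_Suc)
    finally show ?thesis by (simp add: stair_def m Suc)
  qed
  finally show ?thesis .
qed

text \<open>Condensation of the bordered Casorati matrix: dropping the first column shifts z by 1,
  dropping the first row removes the ones. For n = 0 truncated subtraction gives
  \<open>stair 0\<close> = 1, the value prescribed at index -1.\<close>

lemma stair_burchnall_chaundy: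
  fixes H :: "'a::idom fps"
  assumes H0: "fps_nth H 0 = 1" and nz: "stair n H \<noteq> 0"
  shows "stair (n + 1) ((1 + fps_X) * H) * stair (n - 1) H - stair (n + 1) H * stair (n - 1) ((1 + fps_X) * H)
    = stair n H * stair n ((1 + fps_X) * H)"
proof -
  let ?H = "(1 + fps_X) * H" and ?A = "casorati_one (n + 2) H"
  have A: "?A \<in> carrier_mat (n + 2) (n + 2)" by (simp add: casorati_one_def)
  have shift: "fps_nth ((1 + fps_X) ^ j * ?H) k = fps_nth ((1 + fps_X) ^ Suc j * H) k" for j k
    by (simp add: mult_ac)
  have H0': "fps_nth ?H 0 = 1" using H0 by simp
  have detA: "det ?A = stair n H" using det_casorati_one[OF H0, of "n + 2"] by simp
  have "mat_delete ?A 0 0 = casorati (n + 1) ?H"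
    by (rule eq_matI) (simp_all add: mat_delete_def casorati_one_def casorati_def shift del: power_Suc)
  then have 1: "det (mat_delete ?A 0 0) = stair (n + 1) ?H" by (simp add: det_casorati)
  have "mat_delete (mat_delete ?A 0 0) n n = casorati n ?H"
    by (rule eq_matI) (simp_all add: mat_delete_def casorati_one_def casorati_def shift del: power_Suc)
  then have 2: "det (mat_delete (mat_delete ?A 0 0) n n) = stair n ?H" by (simp add: det_casorati)
  have "mat_delete ?A 0 (n + 1) = casorati (n + 1) H"
    by (rule eq_matI) (simp_all add: mat_delete_def casorati_one_def casorati_def del: power_Suc)
  then have 3: "det (mat_delete ?A 0 (n + 1)) = stair (n + 1) H" by (simp add: det_casorati)
  have "mat_delete ?A (n + 1) (n + 1) = casorati_one (n + 1) H"
    by (rule eq_matI) (simp_all add: mat_delete_def casorati_one_def del: power_Suc)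
  then have 4: "det (mat_delete ?A (n + 1) (n + 1)) = stair (n - 1) H"
    using det_casorati_one[OF H0, of "n + 1"] by simp
  have "mat_delete ?A (n + 1) 0 = casorati_one (n + 1) ?H"
    by (rule eq_matI) (simp_all add: mat_delete_def casorati_one_def shift del: power_Suc)
  then have 5: "det (mat_delete ?A (n + 1) 0) = stair (n - 1) ?H"
    using det_casorati_one[OF H0', of "n + 1"] by simp
  have "det ?A \<noteq> 0" using nz detA by metis
  from det_dodgson[OF A this] show ?thesis
    unfolding detA 1 2 3 4 5 by (simp only: mult_ac)
qed

section \<open>Subrings and localization\<close>

locale unital_subring =
  fixes S :: "'a::comm_ring_1 set"
  assumes one [intro, simp]: "1 \<in> S"
    and diff [intro]: "a \<in> S \<Longrightarrow> b \<in> S \<Longrightarrow> a - b \<in> S"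
    and mult [intro]: "a \<in> S \<Longrightarrow> b \<in> S \<Longrightarrow> a * b \<in> S"
begin

lemma zero [intro, simp]: "0 \<in> S"
  using diff[OF one one] by simp

lemma minus [intro]: "a \<in> S \<Longrightarrow> - a \<in> S"
  using diff[OF zero, of a] by simp

lemma add [intro]: "a \<in> S \<Longrightarrow> b \<in> S \<Longrightarrow> a + b \<in> S"
  using diff[of a "- b"] minus[of b] by simp

lemma sum [intro]: "(\<And>i. i \<in> A \<Longrightarrow> f i \<in> S) \<Longrightarrow> sum f A \<in> S"
  by (induction A rule: infinite_finite_induct) auto

lemma prod [intro]: "(\<And>i. i \<in> A \<Longrightarrow> f i \<in> S) \<Longrightarrow> prod f A \<in> S"
  by (induction A rule: infinite_finite_induct) auto

lemma power [intro]: "a \<in> S \<Longrightarrow> a ^ n \<in> S"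
  by (induction n) auto

lemma of_nat [intro, simp]: "of_nat n \<in> S"
  by (induction n) auto

lemma of_int [intro, simp]: "of_int n \<in> S"
  by (cases n) (auto simp del: of_nat_Suc)

lemma det [intro]:
  assumes A: "A \<in> carrier_mat n n" and "\<And>i j. i < n \<Longrightarrow> j < n \<Longrightarrow> A $$ (i, j) \<in> S"
  shows "det A \<in> S"
proof -
  have "signof p * (\<Prod>i<n. A $$ (i, p i)) \<in> S" if "p permutes {0..<n}" for p
  proof (intro mult prod)
    show "(signof p :: 'a) \<in> S" by (auto simp: sign_def)
    show "A $$ (i, p i) \<in> S" if "i \<in> {..<n}" for i
      using that assms(2) permutes_in_image[OF \<open>p permutes _\<close>, of i] by simp
  qed
  then show ?thesis by (auto simp: det_def'[OF A] atLeast0LessThan)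
qed

lemma fps_mult_closed:
  "(\<And>k. fps_nth f k \<in> S) \<Longrightarrow> (\<And>k. fps_nth g k \<in> S) \<Longrightarrow> fps_nth (f * g) k \<in> S"
  by (auto simp: fps_mult_nth)

lemma stair_closed: "(\<And>k. fps_nth H k \<in> S) \<Longrightarrow> stair n H \<in> S"
  unfolding stair_def by (rule det[of _ n]) (auto simp: fps_X_power_mult_nth)

end

lemma fps_inverse_closed:
  fixes S :: "'a::field set"
  assumes "unital_subring S" and f: "\<And>k. fps_nth f k \<in> S" and f0: "fps_nth f 0 = 1"
  shows "fps_nth (inverse f) k \<in> S"
proof (induction k rule: less_induct)
  case (less k)
  interpret unital_subring S by fact
  show ?case
  proof (cases k)
    case (Suc m)
    have "fps_nth (f * inverse f) k = 0"
      using f0 inverse_mult_eq_1'[of f] by (simp add: Suc)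
    then have "fps_nth (inverse f) k = - (\<Sum>i=1..k. fps_nth f i * fps_nth (inverse f) (k - i))"
      using f0 by (simp add: fps_mult_nth sum.atLeast_Suc_atMost eq_neg_iff_add_eq_0)
    also have "\<dots> \<in> S"
      using less f by (intro minus sum mult) auto
    finally show ?thesis .
  qed (simp add: f0)
qed

definition localized :: "nat set \<Rightarrow> 'a::comm_ring_1 set \<Rightarrow> 'a set" where
  "localized M S = {x. \<exists>m\<in>M. of_nat m * x \<in> S}"

lemma localizedI: "m \<in> M \<Longrightarrow> of_nat m * x \<in> S \<Longrightarrow> x \<in> localized M S"
  by (auto simp: localized_def)

lemma subset_localized: "1 \<in> M \<Longrightarrow> S \<subseteq> localized M S"
  by (auto simp: localized_def intro: bexI[of _ 1])

lemma unital_subring_localized: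
  assumes "unital_subring S" and "1 \<in> M" and M: "\<And>a b. a \<in> M \<Longrightarrow> b \<in> M \<Longrightarrow> a * b \<in> M"
  shows "unital_subring (localized M S)"
proof -
  interpret unital_subring S by fact
  show ?thesis
  proof
    show "1 \<in> localized M S" using \<open>1 \<in> M\<close> by (auto simp: localized_def intro!: bexI[of _ 1])
    fix a b assume "a \<in> localized M S" "b \<in> localized M S"
    then obtain k l where k: "k \<in> M" "of_nat k * a \<in> S" and l: "l \<in> M" "of_nat l * b \<in> S"
      by (auto simp: localized_def)
    have eq: "of_nat (k * l) * (a - b) = of_nat l * (of_nat k * a) - of_nat k * (of_nat l * b)"
      "of_nat (k * l) * (a * b) = (of_nat k * a) * (of_nat l * b)"
      by (simp_all add: algebra_simps)
    have "of_nat (k * l) * (a - b) \<in> S" "of_nat (k * l) * (a * b) \<in> S"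
      unfolding eq by (rule diff[OF mult[OF of_nat k(2)] mult[OF of_nat l(2)]], rule mult[OF k(2) l(2)])
    then show "a - b \<in> localized M S" "a * b \<in> localized M S"
      using M[OF k(1) l(1)] by (auto intro: localizedI)
  qed
qed

text \<open>By Bezout, coprime denominators \<open>a\<close> and \<open>b\<close> cancel each other.
  This is how the bounds at 2 and away from 2 are joined.\<close>

lemma localized_coprime:
  assumes "unital_subring S" and "of_nat a * x \<in> S" "of_nat b * x \<in> S" "coprime a b"
  shows "x \<in> S"
proof -
  interpret unital_subring S by fact
  obtain u v where "u * int a + v * int b = 1"
    using bezout_int[of "int a" "int b"] assms(4) by auto
  then have "of_int (u * int a + v * int b) * x = x" by simp
  then have "x = of_int u * (of_nat a * x) + of_int v * (of_nat b * x)"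
    by (simp add: algebra_simps)
  also have "\<dots> \<in> S" using assms by (intro add mult[OF of_int])
  finally show ?thesis .
qed

lemma localized_cancel:
  assumes "m \<in> M" "of_nat m * x \<in> localized M S" "\<And>a b. a \<in> M \<Longrightarrow> b \<in> M \<Longrightarrow> a * b \<in> M"
  shows "x \<in> localized M S"
proof -
  obtain k where "k \<in> M" "of_nat k * (of_nat m * x) \<in> S"
    using assms(2) by (auto simp: localized_def)
  then show ?thesis
    using assms by (intro localizedI[of "k * m"]) (auto simp: mult.assoc)
qed

section \<open>Prescribing the initial values\<close>

text \<open>Dividing a series with constant term 1 by its even part leads to this normal form, with
  \<open>t i\<close> at X^(2i+1): one free parameter for each initial value.\<close>

definition tau_series :: "(nat \<Rightarrow> 'a) \<Rightarrow> 'a::comm_ring_1 fps" where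
  "tau_series t = Abs_fps (\<lambda>k. if k = 0 then 1 else if odd k then t (k div 2) else 0)"

lemma tau_series_nth:
  "fps_nth (tau_series t) k = (if k = 0 then 1 else if odd k then t (k div 2) else 0)"
  by (simp add: tau_series_def)

text \<open>The part of the expansion along the first column that does not involve \<open>t n\<close>.\<close>

definition stair_rest :: "nat \<Rightarrow> (nat \<Rightarrow> 'a) \<Rightarrow> 'a::comm_ring_1" where
  "stair_rest n t = (\<Sum>i<n. t i * cofactor (odd_mat (Suc n) (tau_series t)) i 0)"

lemma mat_delete_odd_mat_index:
  assumes "i \<le> n" "i' < n" "j' < n"
  shows "mat_delete (odd_mat (Suc n) H) i 0 $$ (i', j') =
    fps_nth (fps_X ^ j' * H) (if i' < i then 2 * i' else 2 * i' + 2)"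
  using assms by (auto simp: mat_delete_def odd_mat_def fps_X_power_mult_nth)

text \<open>The cofactors of the first column read only coefficients up to 2n, hence only
  \<open>t k\<close> with k < n. This makes the recursion for \<open>t\<close> possible.\<close>

lemma stair_rest_cong:
  assumes "\<And>k. k < n \<Longrightarrow> t k = t' k"
  shows "stair_rest n t = stair_rest n t'"
proof -
  have "mat_delete (odd_mat (Suc n) (tau_series t)) i 0 = mat_delete (odd_mat (Suc n) (tau_series t')) i 0"
    if "i < n" for i
  proof (rule eq_matI)
    fix i' j' assume "i' < dim_row (mat_delete (odd_mat (Suc n) (tau_series t')) i 0)"
      "j' < dim_col (mat_delete (odd_mat (Suc n) (tau_series t')) i 0)"
    then have ij: "i' < n" "j' < n" by (simp_all add: mat_delete_def odd_mat_def)
    have "m div 2 < n" if "odd m" "m \<le> 2 * n" for m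
      using that by (auto elim!: oddE)
    then have "fps_nth (tau_series t) m = fps_nth (tau_series t') m" if "m \<le> 2 * n" for m
      using that assms by (auto simp: tau_series_nth)
    then have "fps_nth (fps_X ^ j' * tau_series t) k = fps_nth (fps_X ^ j' * tau_series t') k" if "k \<le> 2 * n" for k
      using that by (simp add: fps_X_power_mult_nth)
    then show "mat_delete (odd_mat (Suc n) (tau_series t)) i 0 $$ (i', j') =
      mat_delete (odd_mat (Suc n) (tau_series t')) i 0 $$ (i', j')"
      using that ij by (simp add: mat_delete_odd_mat_index)
  qed (simp_all add: mat_delete_def odd_mat_def)
  then show ?thesis using assms by (simp add: stair_rest_def cofactor_def)
qed

text \<open>Expansion along the first column, which is t_0, ..., t_n. The minor at t_n starts with a
  unit row, whose removal leaves the staircase matrix of size n - 1; for n = 0 the minor is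
  empty.\<close>

lemma stair_tau_series:
  "stair (Suc n) (tau_series t) = stair_rest n t + (-1) ^ n * t n * stair (n - 1) (tau_series t)"
proof -
  let ?M = "odd_mat (Suc n) (tau_series t)"
  have "stair (Suc n) (tau_series t) = (\<Sum>i<Suc n. ?M $$ (i, 0) * cofactor ?M i 0)"
    using laplace_expansion_column[OF odd_mat_carrier, of 0 "Suc n"] by (simp add: stair_def)
  also have "\<dots> = (\<Sum>i<Suc n. t i * cofactor ?M i 0)"
    by (intro sum.cong) (simp_all add: tau_series_nth)
  also have "\<dots> = stair_rest n t + t n * cofactor ?M n 0"
    by (simp add: stair_rest_def)
  also have "cofactor ?M n 0 = (-1) ^ n * det (mat_delete ?M n 0)"
    by (simp add: cofactor_def)
  also have "det (mat_delete ?M n 0) = stair (n - 1) (tau_series t)"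
  proof (cases n)
    case 0
    then show ?thesis by (simp add: mat_delete_def odd_mat_def)
  next
    case (Suc m)
    have "det (mat_delete ?M n 0) = det (mat_delete (mat_delete ?M n 0) 0 0)"
      by (rule det_first_row_unit[of _ m])
        (simp_all add: Suc mat_delete_odd_mat_index fps_X_power_mult_nth tau_series_nth,
          simp add: mat_delete_def odd_mat_def)
    also have "mat_delete (mat_delete ?M n 0) 0 0 = odd_mat m (tau_series t)"
      by (rule eq_matI)
        (auto simp: Suc mat_delete_def odd_mat_def fps_X_power_mult_nth simp del: power_Suc)
    finally show ?thesis by (simp add: stair_def Suc)
  qed
  finally show ?thesis by (simp add: mult_ac)
qed

lemma stair_prescribed:
  fixes q :: "nat \<Rightarrow> 'a::field"
  assumes "q 0 = 1" and nz: "\<And>n. q n \<noteq> 0"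
  obtains t where "\<And>n. stair n (tau_series t) = q n"
proof -
  define val where "val n t = (-1) ^ n * (q (Suc n) - stair_rest n t) / q (n - 1)" for n t
  \<comment> \<open>Stage \<open>n\<close> of the recursion is a whole function: the values below
    \<open>n\<close> are final and the others still 0.\<close>
  define s where "s = rec_nat (\<lambda>_. 0) (\<lambda>n t. t(n := val n t))"
  have s_Suc: "s (Suc n) = (s n)(n := val n (s n))" for n by (simp add: s_def)
  define t where "t n = s (Suc n) n" for n
  have s_t: "k < n \<Longrightarrow> s n k = t k" for n k
    by (induction n) (auto simp: s_Suc t_def less_Suc_eq)
  have t: "t n = val n t" for n
    using stair_rest_cong[of n "s n" t] s_t by (simp add: t_def s_Suc val_def)
  have "stair n (tau_series t) = q n" for n
  proof (induction n rule: less_induct)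
    case (less n)
    show ?case
    proof (cases n)
      case (Suc m)
      have "stair n (tau_series t) = stair_rest m t + (-1) ^ m * t m * q (m - 1)"
        using less[of "m - 1"] by (simp add: Suc stair_tau_series)
      also have "(-1) ^ m * t m * q (m - 1) = q (Suc m) - stair_rest m t"
        using nz[of "m - 1"] by (simp add: t[of m] val_def power_add[symmetric] flip: mult.assoc mult_2)
      finally show ?thesis by (simp add: Suc)
    qed (simp add: assms(1))
  qed
  then show ?thesis by (rule that)
qed

lemma stair_rest_closed:
  assumes "unital_subring S" and "\<And>k. k < n \<Longrightarrow> t k \<in> S"
  shows "stair_rest n t \<in> S"
proof -
  interpret unital_subring S by fact
  have "stair_rest n t = stair_rest n (\<lambda>k. if k < n then t k else 0)"
    by (rule stair_rest_cong) simp
  also have "\<dots> \<in> S"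
    unfolding stair_rest_def cofactor_def
    using assms(2)
    by (intro sum mult power minus one det[of _ n])
      (auto simp: mat_delete_odd_mat_index fps_X_power_mult_nth tau_series_nth odd_mat_def mat_delete_def)
  finally show ?thesis .
qed

text \<open>Solving for \<open>t k\<close> divides by \<open>q (k - 1)\<close> only, and k < n keeps
  this index at most n - 2, the last one that may be inverted.\<close>

lemma tau_closed:
  fixes S :: "'a::field set"
  assumes S: "unital_subring S" and q: "\<And>n. stair n (tau_series t) = q n" and nz: "\<And>n. q n \<noteq> 0"
    and "\<And>k. k \<le> n \<Longrightarrow> q k \<in> S" and "\<And>k. k \<le> n - 2 \<Longrightarrow> inverse (q k) \<in> S"
  shows "k < n \<Longrightarrow> t k \<in> S"
proof (induction k rule: less_induct)
  case (less k)
  interpret unital_subring S by fact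
  have "stair_rest k t \<in> S" by (rule stair_rest_closed[OF S]) (use less in auto)
  moreover have "q (Suc k) \<in> S" "inverse (q (k - 1)) \<in> S"
    using assms(4,5) less.prems by auto
  moreover have "t k = (-1) ^ k * (q (Suc k) - stair_rest k t) * inverse (q (k - 1))"
    using stair_tau_series[of k t] nz[of "k - 1"]
    by (simp add: q field_simps power_add[symmetric] flip: mult_2)
  ultimately show ?case by (auto intro!: mult diff power minus)
qed

section \<open>Odd denominators\<close>

text \<open>For k = 0 truncated subtraction reads \<open>double_fact 0\<close> = 1, the usual value
  of (-1)!!.\<close>

lemma double_fact_odd_Suc: "double_fact (2 * Suc k - 1) = (2 * k + 1) * double_fact (2 * k - 1)"
  by (cases k) simp_all

lemma fact_double: "fact (2 * k) = 2 ^ k * fact k * double_fact (2 * k - 1)"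
proof (induction k)
  case (Suc k)
  have "fact (2 * Suc k) = (2 * k + 2) * (2 * k + 1) * (fact (2 * k) :: nat)"
    by (simp add: algebra_simps)
  then show ?case
    unfolding Suc double_fact_odd_Suc by (simp add: algebra_simps)
qed simp

lemma odd_double_fact: "odd (double_fact (2 * k - 1))"
proof (induction k)
  case (Suc k)
  then show ?case unfolding double_fact_odd_Suc by simp
qed simp

text \<open>Legendre's bound on the exponent of 2, by halving: (2k)! = 2^k k! (2k-1)!! adds k to an
  exponent below k.\<close>

lemma fact_two_power:
  assumes "j > 0"
  shows "\<exists>e m. (fact j :: nat) = 2 ^ e * m \<and> odd m \<and> e < j"
  using assms
proof (induction j rule: less_induct)
  case (less j)
  show ?case
  proof (cases "j = 1")
    case False
    define k where "k = j div 2"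
    have k: "0 < k" "k < j" using False less.prems by (auto simp: k_def)
    obtain e m where em: "(fact k :: nat) = 2 ^ e * m" "odd m" "e < k"
      using less.IH[OF k(2) k(1)] by blast
    have *: "fact (2 * k) = 2 ^ (k + e) * (m * double_fact (2 * k - 1))"
      unfolding fact_double em(1) by (simp add: power_add)
    show ?thesis
    proof (cases "even j")
      case True
      then have "j = 2 * k" by (simp add: k_def)
      then show ?thesis
        using * em(2,3) odd_double_fact[of k] by (intro exI[of _ "k + e"] exI[of _ "m * double_fact (2 * k - 1)"]) simp
    next
      case False
      then have j: "j = 2 * k + 1" by (simp add: k_def)
      have "fact j = 2 ^ (k + e) * ((2 * k + 1) * m * double_fact (2 * k - 1))"
        using * by (simp add: j algebra_simps)
      then show ?thesis
        using em(2,3) odd_double_fact[of k] j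
        by (intro exI[of _ "k + e"] exI[of _ "(2 * k + 1) * m * double_fact (2 * k - 1)"]) simp
    qed
  qed (auto intro!: exI[of _ 0])
qed

section \<open>The substitution X -> -X and changes by even factors\<close>

definition reflect :: "'a::comm_ring_1 fps \<Rightarrow> 'a fps" where
  "reflect f = Abs_fps (\<lambda>n. (-1) ^ n * fps_nth f n)"

lemma reflect_nth [simp]: "fps_nth (reflect f) n = (-1) ^ n * fps_nth f n"
  by (simp add: reflect_def)

lemma reflect_mult: "reflect (f * g) = reflect f * reflect g"
proof (rule fps_ext)
  fix n
  have "(-1) ^ n * (fps_nth f i * fps_nth g (n - i)) =
      ((-1) ^ i * fps_nth f i) * ((-1) ^ (n - i) * fps_nth g (n - i))" if "i \<le> n" for i
  proof -
    have "(-1 :: 'a) ^ n = (-1) ^ i * (-1) ^ (n - i)"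
      using that by (simp flip: power_add)
    then show ?thesis by (simp add: mult_ac)
  qed
  then show "fps_nth (reflect (f * g)) n = fps_nth (reflect f * reflect g) n"
    by (simp add: fps_mult_nth sum_distrib_left)
qed

lemma reflect_1 [simp]: "reflect 1 = 1"
  by (rule fps_ext) simp

lemma reflect_add: "reflect (f + g) = reflect f + reflect g"
  by (rule fps_ext) (simp add: algebra_simps)

lemma reflect_reflect [simp]: "reflect (reflect f) = f"
  by (rule fps_ext) (simp flip: mult.assoc power_add mult_2)

lemma reflect_const [simp]: "reflect (fps_const c) = fps_const c"
  by (rule fps_ext) simp

lemma reflect_eq_self_imp_odd_0:
  fixes f :: "'a::field_char_0 fps"
  assumes "reflect f = f" "odd k"
  shows "fps_nth f k = 0"
  using arg_cong[OF assms(1), of "\<lambda>f. fps_nth f k"] assms(2) by simp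

text \<open>The condition says that \<open>B / W\<close> is invariant under X -> -X, hence even. So
  the determinant depends on \<open>B\<close> only through \<open>B / reflect B\<close>.\<close>

lemma stair_gauge:
  fixes B :: "'a::field_char_0 fps"
  assumes "fps_nth B 0 = 1" and W: "fps_nth W 0 = 1" and eq: "B * reflect W = reflect B * W"
  shows "stair n (B * V) = stair n (W * V)"
proof -
  define E where "E = B * inverse W"
  have WW: "W * inverse W = 1" using W by (simp add: inverse_mult_eq_1')
  have "reflect E * (reflect W * W) = E * (reflect W * W)"
  proof -
    have "reflect E * (reflect W * W) = reflect (E * W) * W" by (simp add: reflect_mult mult_ac)
    also have "E * W = B" using WW by (simp add: E_def mult_ac)
    also have "reflect B * W = B * reflect W" using eq by simp
    also have "\<dots> = E * (reflect W * W)" using WW by (simp add: E_def mult_ac)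
    finally show ?thesis .
  qed
  moreover have "fps_nth (reflect W * W) 0 \<noteq> 0" using W by simp
  then have "reflect W * W \<noteq> 0" by fastforce
  ultimately have "reflect E = E" by simp
  then have "stair n (E * (W * V)) = stair n (W * V)"
    using assms by (intro stair_even_mult) (simp_all add: reflect_eq_self_imp_odd_0 E_def)
  moreover have "E * (W * V) = B * V" using WW by (simp add: E_def mult_ac)
  ultimately show ?thesis by simp
qed

section \<open>Differential equation of the binomial series\<close>

lemma reflect_deriv: "fps_deriv (reflect f) = - reflect (fps_deriv f)"
  by (rule fps_ext) (simp add: algebra_simps)

lemma fps_binomial_deriv_mult:
  fixes c :: "'a::field_char_0"
  shows "fps_deriv (fps_binomial c) * (1 + fps_X) = fps_const c * fps_binomial c"
proof -
  have "fps_nth (1 + fps_X :: 'a fps) 0 \<noteq> 0" by simp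
  then show ?thesis
    by (simp add: fps_binomial_deriv fps_divide_unit mult.assoc inverse_mult_eq_1)
qed

lemma fps_binomial_eqI:
  fixes a :: "'a::field_char_0 fps"
  assumes "fps_deriv a * (1 + fps_X) = fps_const c * a" and "fps_nth a 0 = 1"
  shows "a = fps_binomial c"
proof -
  have "fps_nth (1 + fps_X :: 'a fps) 0 \<noteq> 0" by simp
  then have "fps_deriv a = fps_const c * a / (1 + fps_X)"
    by (simp add: fps_divide_unit mult.assoc inverse_mult_eq_1' flip: assms(1))
  then show ?thesis using assms(2) fps_binomial_ODE_unique' by blast
qed

text \<open>Since \<open>(1 + X) / (1 - X) = 1 + 2 Y\<close> for \<open>Y = X / (1 - X)\<close>, the quotient of
  \<open>(1 + X)\<^sup>z\<close> by its reflection is the binomial series in \<open>2 Y\<close>, whose coefficients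
  \<open>2\<^sup>j (z choose j)\<close> have odd denominators.\<close>

lemma binomial_reflect_quotient:
  fixes z :: "'a::field_char_0"
  defines "Y \<equiv> fps_X * inverse (1 - fps_X) :: 'a fps"
  shows "(fps_binomial z oo (2 * Y)) * reflect (fps_binomial z) = fps_binomial z"
proof (rule fps_binomial_eqI)
  let ?B = "fps_binomial z"
  define y :: "'a fps" where "y = inverse (1 - fps_X)"
  define F where "F = ?B oo (2 * Y)"
  have y1: "y * (1 - fps_X) = 1" by (simp add: y_def inverse_mult_eq_1)
  have d: "fps_deriv y * (1 - fps_X) = y"
    using arg_cong[OF y1, of fps_deriv] by simp
  have "fps_deriv y = fps_deriv y * (y * (1 - fps_X))" by (simp add: y1)
  also have "\<dots> = fps_deriv y * (1 - fps_X) * y" by (simp only: mult_ac)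
  finally have dy: "fps_deriv y = y ^ 2" by (simp only: d power2_eq_square)
  have Y0: "fps_nth (2 * Y) 0 = 0" by (simp add: Y_def)
  have "fps_deriv (2 * Y) = 2 * y ^ 2"
  proof -
    have "fps_deriv (2 * Y) = 2 * (y + fps_X * fps_deriv y)"
      by (simp add: Y_def y_def flip: numeral_fps_const)
    moreover have "y * (y * (1 - fps_X)) + fps_X * y ^ 2 = y ^ 2"
      by (simp add: algebra_simps power2_eq_square)
    then have "y + fps_X * y ^ 2 = y ^ 2" by (simp only: y1 mult_1_right)
    ultimately show ?thesis using dy by simp
  qed
  then have dF: "fps_deriv F = (fps_deriv ?B oo (2 * Y)) * (2 * y ^ 2)"
    using fps_compose_deriv[OF Y0, of ?B] by (simp add: F_def)
  have "(fps_deriv ?B oo (2 * Y)) * (1 + 2 * Y) = fps_const z * F"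
    using arg_cong[OF fps_binomial_deriv_mult[of z], of "\<lambda>f. f oo (2 * Y)"] Y0
    by (simp add: F_def fps_compose_mult_distrib fps_compose_add_distrib)
  moreover have "y * (1 - fps_X) + 2 * Y = y * (1 + fps_X)"
    by (simp add: Y_def y_def[symmetric] algebra_simps)
  then have "1 + 2 * Y = y * (1 + fps_X)" by (simp only: y1)
  ultimately have P: "(fps_deriv ?B oo (2 * Y)) * (y * (1 + fps_X)) = fps_const z * F" by simp
  have "fps_deriv F * (1 + fps_X) = 2 * y * ((fps_deriv ?B oo (2 * Y)) * (y * (1 + fps_X)))"
    unfolding dF by (simp only: power2_eq_square mult_ac)
  then have F': "fps_deriv F * (1 + fps_X) = 2 * y * (fps_const z * F)" by (simp only: P)
  have "reflect (fps_deriv ?B * (1 + fps_X)) = reflect (fps_const z * ?B)"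
    by (simp only: fps_binomial_deriv_mult)
  moreover have "reflect fps_X = (- fps_X :: 'a fps)"
    by (rule fps_ext) simp
  ultimately have R: "reflect (fps_deriv ?B) * (1 - fps_X) = fps_const z * reflect ?B"
    by (simp add: reflect_mult reflect_add)
  have "reflect (fps_deriv ?B) = y * (1 - fps_X) * reflect (fps_deriv ?B)" by (simp add: y1)
  also have "\<dots> = y * (reflect (fps_deriv ?B) * (1 - fps_X))" by (simp only: mult_ac)
  finally have R': "fps_deriv (reflect ?B) = - (y * (fps_const z * reflect ?B))"
    by (simp only: reflect_deriv R)
  have "fps_deriv (F * reflect ?B) * (1 + fps_X) =
      F * fps_deriv (reflect ?B) * (1 + fps_X) + fps_deriv F * (1 + fps_X) * reflect ?B"
    by (simp add: algebra_simps)
  also have "\<dots> = y * (1 - fps_X) * (fps_const z * (F * reflect ?B))"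
    unfolding F' R' by (simp add: algebra_simps)
  finally show "fps_deriv (F * reflect ?B) * (1 + fps_X) = fps_const z * (F * reflect ?B)"
    by (simp add: y1)
  show "fps_nth (F * reflect ?B) 0 = 1" by (simp add: F_def)
qed

text \<open>With F = B / B(-X) for B = (1 + X)^z one has F(-X) = 1 / F, and \<open>W\<close> = 2F /
  (1 + F) satisfies W / W(-X) = F. So \<open>W\<close> may replace B, and writing F = 1 + 2G shows
  that its denominators are odd.\<close>

lemma stair_odd_denominator:
  fixes z :: "'a::field_char_0"
  assumes S: "unital_subring S" and z: "z \<in> S" and V: "\<And>k. fps_nth V k \<in> S"
  shows "stair n (fps_binomial z * V) \<in> localized {m. odd m} S"
proof -
  let ?S = "localized {m. odd m} S" and ?B = "fps_binomial z"
  interpret S: unital_subring S by fact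
  interpret L: unital_subring ?S by (rule unital_subring_localized[OF S]) auto
  have sub: "S \<subseteq> ?S" by (rule subset_localized) simp
  define Y :: "'a fps" where "Y = fps_X * inverse (1 - fps_X)"
  define F where "F = ?B oo (2 * Y)"
  define G where "G = fps_const (1 / 2) * (F - 1)"
  define W where "W = (1 + 2 * G) * inverse (1 + G)"
  have half: "fps_const (1 / 2) * (2 :: 'a fps) = 1"
    unfolding numeral_fps_const fps_const_mult by simp
  have FG: "F = 1 + 2 * G" using half by (simp add: G_def flip: mult.assoc) (simp add: mult.commute)
  have F0: "fps_nth F 0 = 1" by (simp add: F_def)
  have G0: "fps_nth G 0 = 0" by (simp add: G_def F0)
  have Ycoeff: "fps_nth (Y ^ i) k \<in> ?S" for i k
  proof -
    have "fps_nth Y k \<in> ?S" for k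
      unfolding Y_def
      by (intro L.fps_mult_closed fps_inverse_closed[OF L.unital_subring_axioms]) auto
    then show ?thesis
      by (induction i arbitrary: k) (auto intro!: L.fps_mult_closed)
  qed
  \<comment> \<open>\<open>G\<close> carries one factor 2 less than \<open>F\<close>; the exponent
    of 2 in i! is still at most i - 1.\<close>
  have binom: "2 ^ (i - 1) * (z gchoose i) \<in> ?S" if i: "i > 0" for i
  proof -
    obtain e m where em: "(fact i :: nat) = 2 ^ e * m" "odd m" "e < i"
      using fact_two_power[OF i] by blast
    have "fact i * (z gchoose i) \<in> S"
      unfolding gbinomial_mult_fact using z by (intro S.prod S.diff) auto
    then have "of_nat (2 ^ (i - 1 - e)) * (of_nat (fact i) * (z gchoose i)) \<in> S"
      by (subst of_nat_fact) (rule S.mult[OF S.of_nat])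
    also have "of_nat (2 ^ (i - 1 - e)) * (of_nat (fact i) * (z gchoose i)) =
        of_nat m * (2 ^ (i - 1) * (z gchoose i))"
    proof -
      have "2 ^ (i - 1 - e) * 2 ^ e = (2 ^ (i - 1) :: 'a)"
        using em(3) by (simp flip: power_add)
      then show ?thesis unfolding em(1) by (simp add: mult_ac)
    qed
    finally show ?thesis using em(2) by (auto intro: localizedI)
  qed
  have Gcoeff: "fps_nth G k \<in> ?S" for k
  proof (cases "k = 0")
    case False
    have "fps_nth G k = (\<Sum>i=0..k. 1 / 2 * ((z gchoose i) * fps_nth ((2 * Y) ^ i) k))"
      using False by (simp add: G_def F_def fps_compose_nth sum_divide_distrib)
    also have "\<dots> = (\<Sum>i=1..k. 1 / 2 * ((z gchoose i) * fps_nth ((2 * Y) ^ i) k))"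
      using False by (simp add: sum.atLeast_Suc_atMost)
    also have "\<dots> = (\<Sum>i=1..k. (2 ^ (i - 1) * (z gchoose i)) * fps_nth (Y ^ i) k)"
    proof (rule sum.cong)
      fix i assume "i \<in> {1..k}"
      then obtain j where j: "i = Suc j" by (cases i) auto
      have "(2 :: 'a fps) ^ i = fps_const (2 ^ i)"
        by (simp only: fps_const_power numeral_fps_const)
      then have "fps_nth ((2 * Y) ^ i) k = 2 ^ i * fps_nth (Y ^ i) k"
        by (simp only: power_mult_distrib fps_mult_left_const_nth)
      then show "1 / 2 * ((z gchoose i) * fps_nth ((2 * Y) ^ i) k) =
          (2 ^ (i - 1) * (z gchoose i)) * fps_nth (Y ^ i) k"
        using j by simp
    qed simp
    also have "\<dots> \<in> ?S" by (intro L.sum L.mult[OF binom Ycoeff]) auto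
    finally show ?thesis .
  qed (simp add: G0)
  have FB: "F * reflect ?B = ?B"
    unfolding F_def Y_def by (rule binomial_reflect_quotient)
  have nz: "?B \<noteq> 0"
    by (metis fps_binomial_nth fps_zero_nth gbinomial_0(1) one_neq_zero)
  have rB: "reflect F * ?B = reflect ?B"
    using arg_cong[OF FB, of reflect] by (simp add: reflect_mult)
  have "(F * reflect F) * ?B = 1 * ?B"
    by (simp only: mult.assoc rB FB mult_1)
  then have rF: "F * reflect F = 1"
    by (simp only: mult_right_cancel[OF nz])
  have r2: "reflect 2 = (2 :: 'a fps)"
    by (simp add: numeral_fps_const)
  have i1: "(1 + G) * inverse (1 + G) = 1"
    using G0 by (simp add: inverse_mult_eq_1')
  from arg_cong[OF i1, of reflect]
  have i2: "(1 + reflect G) * reflect (inverse (1 + G)) = 1"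
    by (simp add: reflect_mult reflect_add)
  have rFG: "reflect F = 1 + 2 * reflect G"
    using arg_cong[OF FG, of reflect] by (simp add: reflect_add reflect_mult r2)
  have "2 * (1 + G) = 1 + F" by (simp add: FG)
  also have "\<dots> = F * (1 + reflect F)" by (simp add: distrib_left rF)
  also have "\<dots> = 2 * (F * (1 + reflect G))" by (simp add: rFG algebra_simps)
  finally have G1: "1 + G = F * (1 + reflect G)"
    by (simp only: mult_left_cancel zero_neq_numeral[symmetric] not_False_eq_True)
  have W: "W = F * inverse (1 + G)" by (simp add: W_def flip: FG)
  have "reflect (inverse (1 + G)) = (1 + G) * inverse (1 + G) * reflect (inverse (1 + G))"
    by (simp only: i1 mult_1)
  also have "\<dots> = W * ((1 + reflect G) * reflect (inverse (1 + G)))"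
    by (simp only: G1 W mult_ac)
  finally have W': "reflect (inverse (1 + G)) = W" by (simp only: i2 mult_1_right)
  have "?B * reflect W = ?B * (reflect F * W)"
    by (subst W) (simp only: reflect_mult W')
  also have "\<dots> = reflect F * ?B * W" by (simp only: mult_ac)
  also have "\<dots> = reflect ?B * W" by (simp only: rB)
  finally have "?B * reflect W = reflect ?B * W" .
  then have "stair n (?B * V) = stair n (W * V)"
    by (intro stair_gauge) (simp_all add: W_def G0)
  also have "\<dots> \<in> ?S"
  proof (intro L.stair_closed L.fps_mult_closed)
    show "fps_nth V k \<in> ?S" for k using V sub by blast
    have "fps_nth (1 + G) k \<in> ?S" for k using Gcoeff[of k] by auto
    moreover have "fps_nth (1 + G + G) k \<in> ?S" for k
      unfolding fps_add_nth by (intro L.add Gcoeff) simp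
    ultimately show "fps_nth W k \<in> ?S" for k
      unfolding W_def mult_2 add.assoc[symmetric]
      using G0 by (intro L.fps_mult_closed fps_inverse_closed[OF L.unital_subring_axioms]) simp_all
  qed
  finally show ?thesis .
qed

section \<open>Denominators away from 2\<close>

text \<open>The coefficient of \<open>x\<^sup>i y\<^sup>j\<close> in \<open>h(x) (h(y) - h(-x)) / (x + y)\<close>.\<close>

definition bez :: "'a::comm_ring_1 fps \<Rightarrow> nat \<Rightarrow> nat \<Rightarrow> 'a" where
  "bez h i j = (\<Sum>s\<le>i. (-1) ^ s * fps_nth h (i - s) * fps_nth h (j + 1 + s))"

lemma fps_mult_nth_Suc:
  "fps_nth (f * g) (Suc n) = fps_nth f 0 * fps_nth g (Suc n) + (\<Sum>k\<le>n. fps_nth f (Suc k) * fps_nth g (n - k))"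
  unfolding fps_mult_nth atLeast0AtMost sum.atMost_Suc_shift by simp

lemma bez_0: "bez h 0 j = fps_nth h 0 * fps_nth h (Suc j)"
  by (simp add: bez_def)

text \<open>For the generating function b, (x + y) b = h(x) h(y) - h(x) h(-x), and the second
  product has no positive power of y. Together with the row i = 0 this recurrence determines
  b.\<close>

lemma bez_step: "bez h (Suc i) j + bez h i (Suc j) = fps_nth h (Suc i) * fps_nth h (Suc j)"
  unfolding bez_def sum.atMost_Suc_shift by (simp add: sum_negf)

lemma bez_unique:
  assumes "\<And>j. R 0 j = fps_nth h 0 * fps_nth h (Suc j)"
    and "\<And>i j. R (Suc i) j + R i (Suc j) = fps_nth h (Suc i) * fps_nth h (Suc j)"
  shows "bez h i j = R i j"
proof (induction i arbitrary: j)
  case (Suc i)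
  then show ?case
    using bez_step[of h i j] assms(2)[of i j] by (metis add_right_cancel)
qed (simp add: assms(1) bez_0)

text \<open>Here b = (u(x) u(y) - 1) / (x + y), which at y = 0 is (u(x) - 1) / x.\<close>

lemma bez_reflect_inverse:
  assumes "reflect u * u = 1" "fps_nth u 0 = 1"
  shows "bez u i 0 = fps_nth u (Suc i)"
proof -
  have "0 = fps_nth (reflect u * u) (Suc i)" using assms(1) by simp
  also have "\<dots> = fps_nth u (Suc i) - bez u i 0"
    using assms(2) unfolding fps_mult_nth_Suc by (simp add: bez_def sum_negf mult_ac)
  finally show ?thesis by simp
qed

text \<open>Since h = uv satisfies h(x) h(-x) = v(x) v(-x), its generating function splits as v(x)
  v(y) (u(x) u(y) - 1) / (x + y) plus that of v.\<close>

lemma bez_mult: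
  assumes u: "reflect u * u = 1" "fps_nth u 0 = 1" and v: "fps_nth v 0 = 1"
  shows "bez (u * v) i j =
    (\<Sum>k\<le>i. \<Sum>l\<le>j. fps_nth v (i - k) * fps_nth v (j - l) * bez u k l) + bez v i j"
proof (rule bez_unique)
  define P where "P i j = (\<Sum>k\<le>i. \<Sum>l\<le>j. fps_nth v (i - k) * fps_nth v (j - l) * bez u k l)" for i j
  define A where "A i = (\<Sum>k\<le>i. fps_nth v (i - k) * fps_nth u (Suc k))" for i
  have h: "fps_nth (u * v) (Suc i) = fps_nth v (Suc i) + A i" for i
    using u(2) unfolding fps_mult_nth_Suc by (simp add: A_def mult_ac)
  show "P 0 j + bez v 0 j = fps_nth (u * v) 0 * fps_nth (u * v) (Suc j)" for j
    using u(2) v by (simp add: h P_def A_def bez_0)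
  fix i j
  have "P (Suc i) j = fps_nth v (Suc i) * A j +
      (\<Sum>k\<le>i. \<Sum>l\<le>j. fps_nth v (i - k) * fps_nth v (j - l) * bez u (Suc k) l)"
    using u(2) unfolding P_def sum.atMost_Suc_shift[of _ i]
    by (simp add: bez_0 A_def sum_distrib_left mult.assoc)
  moreover have "P i (Suc j) = fps_nth v (Suc j) * A i +
      (\<Sum>k\<le>i. \<Sum>l\<le>j. fps_nth v (i - k) * fps_nth v (j - l) * bez u k (Suc l))"
    using u unfolding P_def sum.atMost_Suc_shift[of _ j]
    by (simp add: bez_reflect_inverse[OF u] A_def sum_distrib_left sum.distrib mult_ac)
  ultimately have "P (Suc i) j + P i (Suc j) = fps_nth v (Suc i) * A j + fps_nth v (Suc j) * A i +
      (\<Sum>k\<le>i. \<Sum>l\<le>j. fps_nth v (i - k) * fps_nth v (j - l) * (bez u (Suc k) l + bez u k (Suc l)))"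
    by (simp only: distrib_left sum.distrib add_ac)
  also have "(\<Sum>k\<le>i. \<Sum>l\<le>j. fps_nth v (i - k) * fps_nth v (j - l) * (bez u (Suc k) l + bez u k (Suc l))) =
      A i * A j"
    unfolding bez_step A_def sum_product by (simp add: mult_ac)
  finally show "(P (Suc i) j + bez v (Suc i) j) + (P i (Suc j) + bez v i (Suc j)) =
      fps_nth (u * v) (Suc i) * fps_nth (u * v) (Suc j)"
    using bez_step[of v i j] unfolding h by (simp add: algebra_simps)
qed

text \<open>This comes from the Euler operator applied to \<open>(x + y) b(x, y) = u(x) u(y) - 1\<close>, where
  \<open>u = ((1 + x) / (1 - x))\<^bsup>z/2\<^esup>\<close> satisfies \<open>(1 - x\<^sup>2) u' = z u\<close>.\<close>

lemma bez_euler: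
  fixes z :: "'a::comm_ring_1"
  assumes u0: "fps_nth u 0 = 1" and uw: "u = (1 - fps_X ^ 2) * w" and u': "fps_deriv u = fps_const z * w"
  shows "of_nat (i + j + 1) * bez u i j =
    z * (fps_nth w i * fps_nth w j - fps_nth (fps_X * w) i * fps_nth (fps_X * w) j)"
proof -
  have u1: "fps_nth u (Suc k) = fps_nth w (Suc k) - fps_nth (fps_X * w) k" for k
    unfolding uw by (simp add: left_diff_distrib power2_eq_square mult.assoc)
  have u2: "of_nat (Suc k) * fps_nth u (Suc k) = z * fps_nth w k" for k
    using arg_cong[OF u', of "\<lambda>f. fps_nth f k"] by simp
  show ?thesis
  proof (induction i arbitrary: j)
    case 0
    have "fps_nth w 0 = 1" using u0 by (simp add: uw)
    then show ?case using u2[of j] u0 by (simp add: bez_0)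
  next
    case (Suc i)
    \<comment> \<open>Both \<open>bez\<close> terms have total degree i + j + 1, so one Euler factor
      serves both and the induction hypothesis handles the second.\<close>
    have "of_nat (Suc i + j + 1) * (bez u (Suc i) j + bez u i (Suc j)) =
        of_nat (Suc i) * fps_nth u (Suc i) * fps_nth u (Suc j) +
        fps_nth u (Suc i) * (of_nat (Suc j) * fps_nth u (Suc j))"
      unfolding bez_step by (simp add: algebra_simps)
    also have "\<dots> = z * fps_nth w i * (fps_nth w (Suc j) - fps_nth (fps_X * w) j) +
        (fps_nth w (Suc i) - fps_nth (fps_X * w) i) * (z * fps_nth w j)"
      unfolding u2 by (simp only: u1)
    finally have "of_nat (Suc i + j + 1) * bez u (Suc i) j =
        z * fps_nth w i * (fps_nth w (Suc j) - fps_nth (fps_X * w) j) +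
        (fps_nth w (Suc i) - fps_nth (fps_X * w) i) * (z * fps_nth w j) -
        of_nat (i + Suc j + 1) * bez u i (Suc j)"
      by (simp add: algebra_simps)
    then show ?case
      unfolding Suc by (simp add: algebra_simps)
  qed
qed

section \<open>Super Catalan numbers and double factorials\<close>

text \<open>The quotient is the super Catalan number \<open>S(m, n)\<close>, and
  \<open>4 S(m, n) = S(m + 1, n) + S(m, n + 1)\<close>.\<close>

lemma super_catalan_dvd:
  "(fact m * fact n * fact (m + n) :: int) dvd fact (2 * m) * fact (2 * n)"
proof (induction n arbitrary: m)
  case 0
  have "(fact m * fact (2 * m - m) :: int) dvd fact (2 * m)"
    using fact_fact_dvd_fact[of m m] by (simp add: mult_2)
  then show ?case by (simp add: mult_2)
next
  case (Suc n)
  define M N where "M = int m" and "N = int n"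
  have f2: "fact (2 * Suc k) = (2 * int k + 2) * (2 * int k + 1) * (fact (2 * k) :: int)" for k
    by (simp add: algebra_simps)
  obtain s where s: "fact (2 * m) * fact (2 * n) = fact m * fact n * fact (m + n) * (s :: int)"
    using Suc[of m] by (rule dvdE)
  obtain s' where "fact (2 * Suc m) * fact (2 * n) = fact (Suc m) * fact n * fact (Suc m + n) * (s' :: int)"
    using Suc[of "Suc m"] by (rule dvdE)
  then have "(M + 1) * (2 * (2 * M + 1) * (fact (2 * m) * fact (2 * n))) =
      (M + 1) * (fact m * fact n * ((M + N + 1) * fact (m + n)) * s')"
    unfolding f2 by (simp add: M_def N_def algebra_simps)
  moreover have "M + 1 \<noteq> 0" by (simp add: M_def)
  ultimately have s': "2 * (2 * M + 1) * (fact (2 * m) * fact (2 * n)) =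
      fact m * fact n * ((M + N + 1) * fact (m + n)) * s'"
    by (simp only: mult_left_cancel not_False_eq_True)
  \<comment> \<open>As \<open>s\<close> and \<open>s'\<close> are the quotients for (m, n) and (m +
    1, n), the recurrence makes \<open>4 * s - s'\<close> the one for (m, n + 1).\<close>
  have "fact m * ((N + 1) * fact n) * ((M + N + 1) * fact (m + n)) * (4 * s - s') =
      4 * (N + 1) * (M + N + 1) * (fact m * fact n * fact (m + n) * s) -
      (N + 1) * (fact m * fact n * ((M + N + 1) * fact (m + n)) * s')"
    by (simp add: algebra_simps)
  also have "\<dots> = fact (2 * m) * ((2 * N + 2) * (2 * N + 1) * fact (2 * n))"
    unfolding s[symmetric] s'[symmetric] by (simp add: algebra_simps)
  finally have "fact (2 * m) * fact (2 * Suc n) = fact m * fact (Suc n) * fact (m + Suc n) * (4 * s - s')"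
    unfolding f2 by (simp add: M_def N_def algebra_simps)
  then show ?case by (simp only: dvd_triv_left)
qed

text \<open>Integrality of S(i + 1, j), with each (2k)! written as 2^k k! (2k-1)!!, says that (i + j
  + 1)! divides the right-hand side; and i! j! divides (i + j)!.\<close>

lemma odd_double_fact_dvd:
  "(i + j + 1) * fact i * fact j dvd
    2 ^ (i + j + 1) * double_fact (2 * Suc i - 1) * double_fact (2 * j - 1)"
proof -
  have "fact (Suc i) * fact j * fact (Suc i + j) dvd (fact (2 * Suc i) * fact (2 * j) :: nat)"
  proof -
    have "int (fact (Suc i) * fact j * fact (Suc i + j)) dvd int (fact (2 * Suc i) * fact (2 * j))"
      unfolding of_nat_mult of_nat_fact by (rule super_catalan_dvd)
    then show ?thesis by (simp only: int_dvd_int_iff)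
  qed
  also have "fact (2 * Suc i) * fact (2 * j) = fact (Suc i) * fact j *
      (2 ^ (i + j + 1) * double_fact (2 * Suc i - 1) * double_fact (2 * j - 1))"
    unfolding fact_double by (simp add: power_add mult_ac)
  finally have "fact (i + j + 1) dvd 2 ^ (i + j + 1) * double_fact (2 * Suc i - 1) * double_fact (2 * j - 1)"
    by (simp del: fact_Suc power_Suc)
  moreover have "(i + j + 1) * fact i * fact j dvd (fact (i + j + 1) :: nat)"
  proof -
    have "(fact (i + j + 1) :: nat) = (i + j + 1) * fact (i + j)" by simp
    then show ?thesis
      unfolding mult.assoc by (metis fact_fact_dvd_fact dvd_refl mult_dvd_mono)
  qed
  ultimately show ?thesis by (rule dvd_trans[rotated])
qed

lemma double_fact_odd_mono_dvd: "k \<le> l \<Longrightarrow> double_fact (2 * k - 1) dvd double_fact (2 * l - 1)"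
proof (induction l rule: dec_induct)
  case (step l)
  then show ?case unfolding double_fact_odd_Suc by simp
qed simp

text \<open>Exponential generating functions over \<open>S\<close> are closed under products, as the
  weights of the convolution are binomial coefficients.\<close>

lemma fact_mult_closed:
  fixes f g :: "'a::field_char_0 fps"
  assumes "unital_subring S" and f: "\<And>k. fact k * fps_nth f k \<in> S" and g: "\<And>k. fact k * fps_nth g k \<in> S"
  shows "fact k * fps_nth (f * g) k \<in> S"
proof -
  interpret unital_subring S by fact
  have "fact k * fps_nth (f * g) k =
      (\<Sum>i=0..k. of_nat (k choose i) * ((fact i * fps_nth f i) * (fact (k - i) * fps_nth g (k - i))))"
    unfolding fps_mult_nth sum_distrib_left
    by (intro sum.cong) (auto simp: binomial_fact)
  also have "\<dots> \<in> S"
    by (intro sum mult[OF of_nat mult[OF f g]])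
  finally show ?thesis .
qed

section \<open>The series ((1 + X) / (1 - X))^(z/2) and its denominators\<close>

locale half_series =
  fixes z :: "'a::field_char_0" and S :: "'a set"
  assumes S: "unital_subring S" and z: "z \<in> S"
begin

abbreviation "T \<equiv> localized (range (\<lambda>k. 2 ^ k)) S"

lemma range_two_mult: "a \<in> range (\<lambda>k. 2 ^ k) \<Longrightarrow> b \<in> range (\<lambda>k. 2 ^ k) \<Longrightarrow> a * b \<in> range (\<lambda>k. (2 :: nat) ^ k)"
  by (auto simp flip: power_add)

lemma one_range_two: "1 \<in> range (\<lambda>k. (2 :: nat) ^ k)"
  by (rule range_eqI[of _ _ 0]) simp

sublocale T: unital_subring T
  by (rule unital_subring_localized[OF S]) (use one_range_two range_two_mult in auto)

lemma S_subset: "S \<subseteq> T"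
  by (rule subset_localized[OF one_range_two])

lemma two_power_cancel: "of_nat (2 ^ k) * x \<in> T \<Longrightarrow> x \<in> T"
  by (rule localized_cancel[of "2 ^ k"]) (auto simp: range_two_mult simp del: of_nat_power)

lemma half_z: "z / 2 \<in> T"
  by (rule two_power_cancel[of 1]) (use z S_subset in auto)

text \<open>This is ((1 + X) / (1 - X))^(z/2). Hence \<open>u * reflect u\<close> = 1, and
  \<open>u / reflect u\<close> = u^2 agrees with the quotient of (1 + X)^z by its
  reflection.\<close>

definition u :: "'a fps" where
  "u = fps_binomial (z / 2) * reflect (fps_binomial (- (z / 2)))"

definition w :: "'a fps" where
  "w = u * inverse (1 - fps_X ^ 2)"

lemma u_0 [simp]: "fps_nth u 0 = 1"
  by (simp add: u_def)

lemma binomial_inverse: "fps_binomial (z / 2) * fps_binomial (- (z / 2)) = 1"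
  by (simp flip: fps_binomial_add_mult)

lemma reflect_u: "reflect u * u = 1"
proof -
  have "reflect u * u = reflect (fps_binomial (z / 2) * fps_binomial (- (z / 2))) *
      (fps_binomial (z / 2) * fps_binomial (- (z / 2)))"
    unfolding u_def reflect_mult reflect_reflect by (simp only: mult_ac)
  then show ?thesis by (simp add: binomial_inverse)
qed

lemma one_minus_X2_inverse: "(1 - fps_X ^ 2) * inverse (1 - fps_X ^ 2) = (1 :: 'a fps)"
  by (simp add: inverse_mult_eq_1')

lemma u_w: "u = (1 - fps_X ^ 2) * w"
proof -
  have "(1 - fps_X ^ 2) * w = u * ((1 - fps_X ^ 2) * inverse (1 - fps_X ^ 2))"
    unfolding w_def by (simp only: mult_ac)
  then show ?thesis unfolding one_minus_X2_inverse by simp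
qed

lemma deriv_u: "fps_deriv u = fps_const z * w"
proof -
  let ?B = "fps_binomial (z / 2)" and ?R = "reflect (fps_binomial (- (z / 2)))"
  have B: "fps_deriv ?B * (1 + fps_X) = fps_const (z / 2) * ?B"
    by (rule fps_binomial_deriv_mult)
  have "reflect (fps_deriv (fps_binomial (- (z / 2))) * (1 + fps_X)) =
      reflect (fps_const (- (z / 2)) * fps_binomial (- (z / 2)))"
    by (simp only: fps_binomial_deriv_mult)
  moreover have "reflect fps_X = (- fps_X :: 'a fps)"
    by (rule fps_ext) simp
  ultimately have "reflect (fps_deriv (fps_binomial (- (z / 2)))) * (1 - fps_X) = fps_const (- (z / 2)) * ?R"
    by (simp only: reflect_mult reflect_add reflect_1 reflect_const diff_conv_add_uminus)
  then have R: "fps_deriv ?R * (1 - fps_X) = fps_const (z / 2) * ?R"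
    by (simp add: reflect_deriv flip: fps_const_neg)
  have two: "fps_const (z / 2) + fps_const (z / 2) = fps_const z"
    by simp
  have "fps_deriv u * (1 - fps_X ^ 2) =
      ?B * (fps_deriv ?R * (1 - fps_X)) * (1 + fps_X) + (fps_deriv ?B * (1 + fps_X)) * ?R * (1 - fps_X)"
    by (simp add: u_def algebra_simps power2_eq_square)
  also have "\<dots> = (fps_const (z / 2) + fps_const (z / 2)) * (?B * ?R)"
    unfolding B R by (simp only: algebra_simps) simp
  also have "\<dots> = fps_const z * u" by (simp only: two u_def)
  finally have "fps_deriv u * (1 - fps_X ^ 2) = fps_const z * u" .
  then have "fps_deriv u * ((1 - fps_X ^ 2) * inverse (1 - fps_X ^ 2)) = fps_const z * w"
    unfolding w_def by (metis mult.assoc)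
  then show ?thesis unfolding one_minus_X2_inverse by simp
qed

lemma fact_w: "fact k * fps_nth w k \<in> T"
proof -
  have binom: "fact k * (c gchoose k) \<in> T" if "c \<in> T" for c k
    unfolding gbinomial_mult_fact using that by (intro T.prod T.diff) auto
  have "fact k * fps_nth (reflect (fps_binomial (- (z / 2)))) k \<in> T" for k
  proof -
    have "(-1) ^ k * (fact k * (- (z / 2) gchoose k)) \<in> T"
      using half_z by (intro T.mult[OF _ binom] T.power T.minus) auto
    then show ?thesis by (simp add: mult_ac)
  qed
  moreover have "fact k * fps_nth (inverse (1 - fps_X ^ 2)) k \<in> T" for k
  proof -
    have "fps_nth (inverse (1 - fps_X ^ 2)) k \<in> T"
      by (rule fps_inverse_closed[OF T.unital_subring_axioms])
        (auto simp: fps_X_power_iff)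
    then show ?thesis using T.mult[OF T.of_nat[of "fact k"]] by simp
  qed
  ultimately show ?thesis
    unfolding w_def u_def
    by (intro fact_mult_closed[OF T.unital_subring_axioms]) (use half_z binom in auto)
qed

lemma fact_X_w: "fact k * fps_nth (fps_X * w) k \<in> T"
proof (cases k)
  case (Suc m)
  have "of_nat k * (fact m * fps_nth w m) \<in> T" by (rule T.mult[OF T.of_nat fact_w])
  then show ?thesis by (simp add: Suc algebra_simps)
qed simp

text \<open>\<open>bez_euler\<close> bounds the denominator by (i + j + 1) i! j!, and
  \<open>odd_double_fact_dvd\<close> replaces this by odd double factorials up to a power of 2, a
  unit in \<open>T\<close>.\<close>

lemma bez_u_closed: "of_nat (double_fact (2 * Suc i - 1) * double_fact (2 * j - 1)) * bez u i j \<in> T"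
proof (rule two_power_cancel)
  obtain c where c: "2 ^ (i + j + 1) * double_fact (2 * Suc i - 1) * double_fact (2 * j - 1) =
      (i + j + 1) * fact i * fact j * c"
    using odd_double_fact_dvd by (rule dvdE)
  have "of_nat (2 ^ (i + j + 1)) * (of_nat (double_fact (2 * Suc i - 1) * double_fact (2 * j - 1)) * bez u i j) =
      of_nat (2 ^ (i + j + 1) * double_fact (2 * Suc i - 1) * double_fact (2 * j - 1)) * bez u i j"
    by (simp only: of_nat_mult mult.assoc)
  also have "\<dots> = of_nat c * (fact i * fact j * (of_nat (i + j + 1) * bez u i j))"
    unfolding c by (simp only: of_nat_mult of_nat_fact mult_ac)
  also have "\<dots> = of_nat c * (z * ((fact i * fps_nth w i) * (fact j * fps_nth w j) -
      (fact i * fps_nth (fps_X * w) i) * (fact j * fps_nth (fps_X * w) j)))"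
    unfolding bez_euler[OF u_0 u_w deriv_u] by (simp add: algebra_simps)
  also have "\<dots> \<in> T"
    using z S_subset by (intro T.mult[OF T.of_nat] T.mult[OF _ T.diff] T.mult[OF fact_w fact_w]
        T.mult[OF fact_X_w fact_X_w]) auto
  finally show "of_nat (2 ^ (i + j + 1)) *
      (of_nat (double_fact (2 * Suc i - 1) * double_fact (2 * j - 1)) * bez u i j) \<in> T" .
qed

lemma bez_uv_closed:
  assumes v: "\<And>k. fps_nth v k \<in> S" and v0: "fps_nth v 0 = 1"
  shows "of_nat (double_fact (2 * Suc i - 1) * double_fact (2 * j - 1)) * bez (u * v) i j \<in> T"
proof -
  let ?D = "\<lambda>i j. double_fact (2 * Suc i - 1) * double_fact (2 * j - 1)"
  have v': "fps_nth v k \<in> T" for k using v S_subset by blast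
  have 1: "of_nat (?D i j) * bez u k l \<in> T" if kl: "k \<le> i" "l \<le> j" for k l
  proof -
    have "?D k l dvd ?D i j"
      using kl by (intro mult_dvd_mono double_fact_odd_mono_dvd) auto
    then obtain c where c: "?D i j = ?D k l * c" by (rule dvdE)
    have "of_nat (?D i j) * bez u k l = of_nat c * (of_nat (?D k l) * bez u k l)"
      unfolding c by (simp only: of_nat_mult mult_ac)
    also have "\<dots> \<in> T" by (rule T.mult[OF T.of_nat bez_u_closed])
    finally show ?thesis .
  qed
  have "of_nat (?D i j) * bez (u * v) i j =
      (\<Sum>k\<le>i. \<Sum>l\<le>j. fps_nth v (i - k) * fps_nth v (j - l) * (of_nat (?D i j) * bez u k l)) +
      of_nat (?D i j) * bez v i j"
    unfolding bez_mult[OF reflect_u u_0 v0] distrib_left sum_distrib_left by (simp only: mult_ac)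
  also have "\<dots> \<in> T"
  proof (intro T.add T.sum)
    fix k l assume "k \<in> {..i}" "l \<in> {..j}"
    then show "fps_nth v (i - k) * fps_nth v (j - l) * (of_nat (?D i j) * bez u k l) \<in> T"
      by (intro T.mult[OF T.mult[OF v' v'] 1]) auto
  next
    have "bez v i j \<in> T"
      unfolding bez_def using v' by (intro T.sum T.mult T.power T.minus) auto
    then show "of_nat (?D i j) * bez v i j \<in> T" by (rule T.mult[OF T.of_nat])
  qed
  finally show ?thesis .
qed

end

text \<open>Each entry is a convolution of X^j h(-X) with h, cut off at k < n. It is complete when
  2i+1 < n; otherwise the substitution s = n - 1 - k turns the truncated sum into a value of
  \<open>bez\<close>.\<close>

lemma odd_mat_mult_reflect:
  assumes ij: "i < n" "j < n" and h0: "fps_nth h 0 = 1"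
  defines "C \<equiv> mat n n (\<lambda>(k, j). fps_nth (fps_X ^ j * reflect h) k)"
  shows "(odd_mat n h * C) $$ (i, j) =
    (if 2 * i + 1 < n then fps_nth (fps_X ^ j * (reflect h * h)) (2 * i + 1)
     else (-1) ^ (n - 1 - j) * bez h (n - 1 - j) (2 * i + 1 - n))"
proof -
  define m where "m = 2 * i + 1"
  let ?f = "fps_X ^ j * reflect h"
  have "(odd_mat n h * C) $$ (i, j) = (\<Sum>k<n. fps_nth (fps_X ^ k * h) m * fps_nth ?f k)"
    using ij carrier_matD[OF odd_mat_carrier[of n h]] by (simp add: scalar_prod_def C_def atLeast0LessThan m_def)
  also have "\<dots> = (if m < n then fps_nth (?f * h) m else (-1) ^ (n - 1 - j) * bez h (n - 1 - j) (m - n))"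
  proof (cases "m < n")
    case True
    have "(\<Sum>k<n. fps_nth (fps_X ^ k * h) m * fps_nth ?f k) = (\<Sum>k\<le>m. fps_nth (fps_X ^ k * h) m * fps_nth ?f k)"
      using True by (intro sum.mono_neutral_right) (auto simp: fps_X_power_mult_nth)
    also have "\<dots> = (\<Sum>k\<le>m. fps_nth h (m - k) * fps_nth ?f k)"
      by (intro sum.cong refl) (simp add: fps_X_power_mult_nth[of _ h])
    also have "\<dots> = (\<Sum>k\<le>m. fps_nth ?f k * fps_nth h (m - k))"
      by (rule sum.cong[OF refl mult.commute])
    also have "\<dots> = fps_nth (?f * h) m"
      by (simp only: fps_mult_nth[of ?f h] atLeast0AtMost)
    finally show ?thesis using True by (simp only: if_True)
  next
    case False
    define I where "I = n - 1 - j"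
    have "(\<Sum>k<n. fps_nth (fps_X ^ k * h) m * fps_nth ?f k) =
        (\<Sum>k\<in>{j..<n}. fps_nth (fps_X ^ k * h) m * fps_nth ?f k)"
      by (intro sum.mono_neutral_right) (auto simp: fps_X_power_mult_nth)
    also have "\<dots> = (\<Sum>s\<le>I. (-1) ^ I * ((-1) ^ s * fps_nth h (I - s) * fps_nth h (m - n + 1 + s)))"
    proof (rule sum.reindex_bij_witness[of _ "\<lambda>s. j + (I - s)" "\<lambda>k. I - (k - j)"])
      fix k assume k: "k \<in> {j..<n}"
      define s where "s = I - (k - j)"
      have s: "s \<le> I" "I - s = k - j" "m - n + 1 + s = m - k"
        using k ij False by (auto simp: s_def I_def)
      have "(-1 :: 'a) ^ (k - j) = (-1) ^ I * (-1) ^ s"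
      proof -
        have "(-1 :: 'a) ^ I = (-1) ^ (k - j) * (-1) ^ s"
          using s(1,2) by (metis le_add_diff_inverse2 power_add)
        moreover have "(-1 :: 'a) ^ s * (-1) ^ s = 1" by (simp flip: power_mult_distrib)
        ultimately show ?thesis by (simp add: mult.assoc)
      qed
      moreover have "fps_nth (fps_X ^ k * h) m = fps_nth h (m - k)"
        "fps_nth ?f k = (-1) ^ (k - j) * fps_nth h (k - j)"
        using k False by (simp_all add: fps_X_power_mult_nth)
      ultimately show "(-1) ^ I * ((-1) ^ (I - (k - j)) * fps_nth h (I - (I - (k - j))) *
          fps_nth h (m - n + 1 + (I - (k - j)))) = fps_nth (fps_X ^ k * h) m * fps_nth ?f k"
        unfolding s_def[symmetric] s(2,3) by (simp only: mult_ac)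
    qed (use ij in \<open>auto simp: I_def\<close>)
    finally show ?thesis
      using False by (simp add: bez_def sum_distrib_left I_def)
  qed
  finally show ?thesis by (simp add: m_def mult_ac)
qed

section \<open>Row and column weights, and descent from S[1/2] to S\<close>

context half_series
begin

text \<open>The series u drops out of \<open>reflect h * h\<close>, so rows with 2i+1 < n involve
  only v. In the other rows the bound of \<open>bez_uv_closed\<close> splits into a row weight and
  the column weight (2(n-j)-1)!!; the column weights multiply to \<open>A_prod n\<close>.\<close>

lemma stair_uv_closed:
  assumes v: "\<And>k. fps_nth v k \<in> S" and v0: "fps_nth v 0 = 1"
  shows "of_nat (A_prod n) * stair n (u * v) \<in> T"
proof -
  let ?D = "\<lambda>k. double_fact (2 * k - 1)"
  define h where "h = u * v"
  have h0: "fps_nth h 0 = 1" using v0 by (simp add: h_def)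
  have v': "fps_nth v k \<in> T" for k using v S_subset by blast
  have Dnz: "of_nat (?D k) \<noteq> (0 :: 'a)" for k
    using odd_double_fact[of k] by (auto intro: gr0I)
  have hh: "reflect h * h = reflect v * v"
  proof -
    have "reflect h * h = (reflect u * u) * (reflect v * v)"
      unfolding h_def reflect_mult by (simp only: mult_ac)
    then show ?thesis by (simp add: reflect_u)
  qed
  have hh_closed: "fps_nth (reflect v * v) k \<in> T" for k
    using v' by (intro T.fps_mult_closed) (auto intro!: T.mult T.power T.minus)
  have hh_odd: "fps_nth (reflect v * v) k = 0" if "odd k" for k
    by (rule reflect_eq_self_imp_odd_0) (use that in \<open>simp_all add: reflect_mult mult.commute\<close>)
  define C where "C = mat n n (\<lambda>(k, j). fps_nth (fps_X ^ j * reflect h) k)"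
  have C: "C \<in> carrier_mat n n" by (simp add: C_def)
  have "det C = 1"
    by (rule det_unit_lower_triangular[OF C]) (simp_all add: C_def fps_X_power_mult_nth h0)
  define X where "X = odd_mat n h * C"
  have X: "X \<in> carrier_mat n n" unfolding X_def by (rule mult_carrier_mat[OF odd_mat_carrier C])
  have detX: "det X = stair n h"
    using det_mult[OF odd_mat_carrier C] \<open>det C = 1\<close> by (simp add: X_def stair_def)
  \<comment> \<open>The rows with \<open>2i + 1 < n\<close> and the columns with odd \<open>j\<close> contribute an integral factor; their
     weights cancel, so that only \<open>A\<^sub>n\<close> remains.\<close>
  define r where "r i = (if n \<le> 2 * i + 1 then of_nat (?D (2 * i + 1 - n)) else 1 / of_nat (?D (n - 1 - 2 * i)) :: 'a)" for i
  define Y where "Y = mat n n (\<lambda>(i, j). r i * X $$ (i, j) * of_nat (?D (n - j)))"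
  have "det Y \<in> T"
  proof (rule T.det)
    show "Y \<in> carrier_mat n n" by (simp add: Y_def)
    fix i j assume ij: "i < n" "j < n"
    have Xij: "X $$ (i, j) =
        (if 2 * i + 1 < n then fps_nth (fps_X ^ j * (reflect v * v)) (2 * i + 1)
         else (-1) ^ (n - 1 - j) * bez h (n - 1 - j) (2 * i + 1 - n))"
      unfolding X_def C_def odd_mat_mult_reflect[OF ij h0] hh ..
    show "Y $$ (i, j) \<in> T"
    proof (cases "2 * i + 1 < n")
      case False
      have "Suc (n - 1 - j) = n - j" using ij by simp
      then have "of_nat (?D (n - j) * ?D (2 * i + 1 - n)) * bez h (n - 1 - j) (2 * i + 1 - n) \<in> T"
        using bez_uv_closed[OF v v0, of "n - 1 - j" "2 * i + 1 - n"] unfolding h_def by metis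
      then have "(-1) ^ (n - 1 - j) *
          (of_nat (?D (n - j) * ?D (2 * i + 1 - n)) * bez h (n - 1 - j) (2 * i + 1 - n)) \<in> T"
        by (intro T.mult[OF T.power[OF T.minus[OF T.one]]])
      then show ?thesis
        using ij False by (simp add: Y_def Xij r_def mult_ac)
    next
      case True
      show ?thesis
      proof (cases "j \<le> 2 * i + 1 \<and> odd j")
        case False
        have "X $$ (i, j) = 0"
        proof (cases "j \<le> 2 * i + 1")
          case True
          then have "odd (2 * i + 1 - j)" using False by auto
          then show ?thesis using True \<open>2 * i + 1 < n\<close> by (simp add: Xij fps_X_power_mult_nth hh_odd)
        next
          case False
          then show ?thesis using \<open>2 * i + 1 < n\<close> by (simp add: Xij fps_X_power_mult_nth)
        qed
        then show ?thesis using ij by (simp add: Y_def)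
      next
        case j: True
        have "?D (n - 1 - 2 * i) dvd ?D (n - j)"
          using j True by (intro double_fact_odd_mono_dvd) auto
        then obtain c where c: "?D (n - j) = ?D (n - 1 - 2 * i) * c" by (rule dvdE)
        have "Y $$ (i, j) = 1 / of_nat (?D (n - 1 - 2 * i)) * X $$ (i, j) * of_nat (?D (n - j))"
          using ij True by (simp add: Y_def r_def)
        also have "\<dots> = of_nat c * X $$ (i, j)"
          unfolding c of_nat_mult using Dnz[of "n - 1 - 2 * i"] by (simp only: divide_inverse mult_1_left) (simp add: field_simps)
        also have "X $$ (i, j) = fps_nth (reflect v * v) (2 * i + 1 - j)"
          using True j by (simp add: Xij fps_X_power_mult_nth)
        finally have "Y $$ (i, j) = of_nat c * fps_nth (reflect v * v) (2 * i + 1 - j)" .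
        then show ?thesis using T.mult[OF T.of_nat hh_closed] by simp
      qed
    qed
  qed
  \<comment> \<open>Under i -> n - 1 - i the integer 2i + 1 - n changes sign, which exchanges the
    two cases of \<open>r\<close>; a middle row has weight 1.\<close>
  have r: "r i * r (n - Suc i) = 1" if i: "i < n" for i
  proof (cases "n = 2 * i + 1")
    case True
    then have "n - Suc i = i" by simp
    then show ?thesis using True by (simp add: r_def)
  next
    case False
    show ?thesis
    proof (cases "n < 2 * i + 1")
      case True
      then have "\<not> n \<le> 2 * (n - Suc i) + 1" "n - 1 - 2 * (n - Suc i) = 2 * i + 1 - n"
        using i by auto
      then have "r (n - Suc i) = 1 / of_nat (?D (2 * i + 1 - n))" by (simp only: r_def if_False)
      moreover have "r i = of_nat (?D (2 * i + 1 - n))" using True by (simp add: r_def)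
      ultimately show ?thesis using Dnz by (simp only: times_divide_eq_right mult_1_right divide_self_if) simp
    next
      case F: False
      then have "n \<le> 2 * (n - Suc i) + 1" "2 * (n - Suc i) + 1 - n = n - 1 - 2 * i"
        using i False by auto
      then have "r (n - Suc i) = of_nat (?D (n - 1 - 2 * i))" by (simp only: r_def if_True)
      moreover have "r i = 1 / of_nat (?D (n - 1 - 2 * i))" using F False by (simp add: r_def)
      ultimately show ?thesis using Dnz by (simp only: times_divide_eq_left mult_1_left divide_self_if) simp
    qed
  qed
  \<comment> \<open>The pairing uses every weight twice, so it yields \<open>P * P\<close> = 1 and P
    is a sign.\<close>
  define P where "P = (\<Prod>i<n. r i)"
  have "P * P = (\<Prod>i<n. r i) * (\<Prod>i<n. r (n - Suc i))"
    unfolding P_def using prod.nat_diff_reindex[of r n] by simp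
  also have "\<dots> = 1" using r by (simp flip: prod.distrib)
  finally have "P = 1 \<or> P = -1" by (simp add: power2_eq_1_iff flip: power2_eq_square)
  then have P: "P * P = 1" "P \<in> T" by auto
  have A: "(\<Prod>j<n. of_nat (?D (n - j))) = (of_nat (A_prod n) :: 'a)"
  proof -
    have "(\<Prod>j<n. ?D (n - j)) = (\<Prod>j<n. ?D (Suc j))"
      using prod.nat_diff_reindex[of "\<lambda>j. ?D (Suc j)" n] by (simp add: Suc_diff_Suc)
    also have "\<dots> = A_prod n"
      unfolding A_prod_def by (intro prod.reindex_bij_witness[of _ "\<lambda>j. j - 1" Suc]) auto
    finally show ?thesis by (simp flip: of_nat_prod)
  qed
  have "det Y = P * stair n h * of_nat (A_prod n)"
    unfolding Y_def det_scale[OF X] detX A P_def ..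
  then have "P * det Y = (P * P) * (of_nat (A_prod n) * stair n h)"
    by (simp only: mult_ac)
  then have "of_nat (A_prod n) * stair n h = P * det Y" by (simp add: P(1))
  then show ?thesis using T.mult[OF P(2) \<open>det Y \<in> T\<close>] by (simp add: h_def)
qed

text \<open>(1 + X)^z and u have the same quotient by their reflections, so the bound over S[1/2]
  carries over to (1 + X)^z. With the odd multiplier of \<open>stair_odd_denominator\<close> it
  descends to S.\<close>

lemma stair_binomial_closed:
  assumes v: "\<And>k. fps_nth v k \<in> S" and v0: "fps_nth v 0 = 1"
  shows "of_nat (A_prod n) * stair n (fps_binomial z * v) \<in> S"
proof -
  interpret S: unital_subring S by (rule S)
  let ?b = "fps_binomial (z / 2)" and ?c = "fps_binomial (- (z / 2))"
  let ?x = "of_nat (A_prod n) * stair n (fps_binomial z * v)"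
  have b: "fps_binomial z = ?b * ?b"
    by (simp flip: fps_binomial_add_mult)
  have "fps_binomial z * reflect u = (?b * ?c) * (?b * reflect ?b)"
    unfolding b u_def reflect_mult reflect_reflect by (simp only: mult_ac)
  moreover have "reflect (fps_binomial z) * u = reflect (?b * ?c) * (?b * reflect ?b)"
    unfolding b u_def reflect_mult reflect_reflect by (simp only: mult_ac)
  ultimately have "fps_binomial z * reflect u = reflect (fps_binomial z) * u"
    unfolding binomial_inverse by simp
  then have "stair n (fps_binomial z * v) = stair n (u * v)"
    by (intro stair_gauge) simp_all
  then have "?x \<in> T" using stair_uv_closed[OF v v0] by simp
  then obtain k where k: "of_nat (2 ^ k) * ?x \<in> S"
    by (auto simp: localized_def)
  have "stair n (fps_binomial z * v) \<in> localized {m. odd m} S"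
    by (rule stair_odd_denominator[OF S z v])
  then obtain m where m: "odd m" "of_nat m * stair n (fps_binomial z * v) \<in> S"
    by (auto simp: localized_def)
  have "of_nat m * ?x = of_nat (A_prod n) * (of_nat m * stair n (fps_binomial z * v))"
    by (simp only: mult_ac)
  also have "\<dots> \<in> S" by (rule S.mult[OF S.of_nat m(2)])
  finally have "of_nat m * ?x \<in> S" .
  then show ?thesis
    by (rule localized_coprime[OF S k]) (use m(1) in simp)
qed

end

section \<open>The polynomials\<close>

text \<open>\<open>fps_binomial\<close> is used over a field of characteristic 0, so z is taken in
  the fraction field of the polynomials; the coefficients themselves form a fraction field.\<close>

instance fract :: ("{idom, ring_char_0}") field_char_0
proof
  show "inj (of_nat :: nat \<Rightarrow> 'a fract)"
    by (rule injI) (simp add: of_nat_fract eq_fract)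
qed

definition fps_hom :: "('a \<Rightarrow> 'b) \<Rightarrow> 'a::comm_ring_1 fps \<Rightarrow> 'b::comm_ring_1 fps" where
  "fps_hom \<phi> H = Abs_fps (\<lambda>k. \<phi> (fps_nth H k))"

definition binomial_poly :: "nat \<Rightarrow> 'a::field_char_0 poly" where
  "binomial_poly k = [:1 / fact k:] * (\<Prod>i<k. [:0, 1:] - of_nat i)"

definition stair_poly :: "(nat \<Rightarrow> 'a) \<Rightarrow> nat \<Rightarrow> 'a::field_char_0 poly" where
  "stair_poly t n = stair n (Abs_fps binomial_poly * tau_series (\<lambda>k. [:t k:]))"

context comm_ring_hom
begin

lemma fps_hom_mult: "fps_hom hom (f * g) = fps_hom hom f * fps_hom hom g"
  by (rule fps_ext) (simp add: fps_hom_def fps_mult_nth hom_distribs)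

lemma fps_hom_tau_series: "fps_hom hom (tau_series t) = tau_series (\<lambda>k. hom (t k))"
  by (rule fps_ext) (simp add: fps_hom_def tau_series_nth)

lemma stair_hom: "hom (stair n H) = stair n (fps_hom hom H)"
proof -
  have "odd_mat n (fps_hom hom H) = map_mat hom (odd_mat n H)"
    by (rule eq_matI) (auto simp: odd_mat_def fps_hom_def fps_X_power_mult_nth)
  then show ?thesis by (simp add: stair_def)
qed

end

text \<open>One transfer serves evaluation at 0, the embedding into the fraction field, and the
  shift followed by this embedding.\<close>

lemma stair_poly_hom:
  fixes \<phi> :: "'a::field_char_0 poly \<Rightarrow> 'b::field_char_0"
  assumes "comm_ring_hom \<phi>"
  shows "\<phi> (stair_poly t n) = stair n (fps_binomial (\<phi> [:0, 1:]) * tau_series (\<lambda>k. \<phi> [:t k:]))"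
proof -
  interpret comm_ring_hom \<phi> by fact
  have "\<phi> (binomial_poly k) = \<phi> [:0, 1:] gchoose k" for k
  proof -
    have "\<phi> (fact k) = fact k"
      using hom_of_nat[of "fact k"] by (simp only: of_nat_fact)
    moreover have "(fact k :: 'a poly) = [:fact k:]"
      using of_nat_poly[of "fact k", where 'a = 'a] by (simp only: of_nat_fact)
    then have "fact k * [:1 / fact k :: 'a:] = 1"
      by (simp add: one_pCons)
    ultimately have "fact k * \<phi> [:1 / fact k:] = 1"
      by (metis hom_mult hom_one)
    moreover have "fact k * (\<phi> [:0, 1:] gchoose k) = (\<Prod>i<k. \<phi> [:0, 1:] - of_nat i)"
      by (simp add: gbinomial_mult_fact atLeast0LessThan)
    ultimately have "fact k * \<phi> (binomial_poly k) = fact k * (\<phi> [:0, 1:] gchoose k)"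
      unfolding binomial_poly_def hom_mult hom_prod mult.assoc[symmetric]
      by (simp add: hom_minus hom_of_nat)
    then show ?thesis by simp
  qed
  then have "fps_hom \<phi> (Abs_fps binomial_poly) = fps_binomial (\<phi> [:0, 1:])"
    by (intro fps_ext) (simp add: fps_hom_def)
  then show ?thesis
    by (simp add: stair_poly_def stair_hom fps_hom_mult fps_hom_tau_series)
qed

section \<open>Evaluation, embedding and shift of the polynomials\<close>

lemma comm_ring_hom_to_fract: "comm_ring_hom (to_fract :: 'a::idom \<Rightarrow> 'a fract)"
  by unfold_locales simp_all

lemma comm_ring_hom_poly_eval: "comm_ring_hom (\<lambda>p. poly p a :: 'a::comm_ring_1)"
  by unfold_locales simp_all

lemma comm_ring_hom_to_fract_shift: "comm_ring_hom (\<lambda>p. to_fract (shift p) :: 'a::idom poly fract)"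
  by unfold_locales (simp_all add: shift_def pcompose_add pcompose_mult pcompose_1)

lemma stair_poly_0: "poly (stair_poly t n) 0 = stair n (tau_series t)"
  using stair_poly_hom[OF comm_ring_hom_poly_eval[of 0], of t n] by simp

lemma to_fract_stair_poly:
  "to_fract (stair_poly t n) =
    stair n (fps_binomial (to_fract [:0, 1:]) * tau_series (\<lambda>k. to_fract [:t k:]))"
  by (rule stair_poly_hom[OF comm_ring_hom_to_fract])

lemma to_fract_shift_stair_poly:
  "to_fract (shift (stair_poly t n)) =
    stair n ((1 + fps_X) * (fps_binomial (to_fract [:0, 1:]) * tau_series (\<lambda>k. to_fract [:t k:])))"
proof -
  have "shift [:0, 1 :: 'a:] = [:0, 1:] + 1" "shift [:c:] = [:c:]" for c :: 'a
    by (simp_all add: shift_def pcompose_pCons one_pCons)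
  then have "to_fract (shift (stair_poly t n)) =
      stair n (fps_binomial (to_fract [:0, 1:] + 1) * tau_series (\<lambda>k. to_fract [:t k:]))"
    using stair_poly_hom[OF comm_ring_hom_to_fract_shift, of t n] by simp
  then show ?thesis
    by (simp add: fps_binomial_add_mult fps_binomial_1 mult_ac)
qed

text \<open>The nonvanishing required by the condensation comes from the value at z = 0, and
  injectivity of \<open>to_fract\<close> brings the identity back to polynomials.\<close>

lemma stair_poly_burchnall_chaundy:
  assumes "stair n (tau_series t) \<noteq> 0"
  shows "shift (stair_poly t (n + 1)) * stair_poly t (n - 1) - stair_poly t (n + 1) * shift (stair_poly t (n - 1))
    = stair_poly t n * shift (stair_poly t n)"
proof -
  define H where "H = fps_binomial (to_fract [:0, 1 :: 'a:]) * tau_series (\<lambda>k. to_fract [:t k:])"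
  have "stair_poly t n \<noteq> 0" using assms stair_poly_0[of t n] by auto
  then have "stair n H \<noteq> 0"
    unfolding H_def to_fract_stair_poly[symmetric] by simp
  moreover have "fps_nth H 0 = 1" by (simp add: H_def tau_series_nth)
  ultimately have "to_fract (shift (stair_poly t (n + 1)) * stair_poly t (n - 1) -
      stair_poly t (n + 1) * shift (stair_poly t (n - 1))) = to_fract (stair_poly t n * shift (stair_poly t n))"
    unfolding to_fract_diff to_fract_mult to_fract_stair_poly to_fract_shift_stair_poly
    using stair_burchnall_chaundy[of H n] unfolding H_def by blast
  then show ?thesis by (simp only: to_fract_eq_iff)
qed

lemma stair_poly_closed:
  fixes R :: "'a::field_char_0 poly set"
  assumes R: "unital_subring R" and "[:0, 1:] \<in> R" and t: "\<And>k. k < n \<Longrightarrow> [:t k:] \<in> R"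
  shows "smult (of_nat (A_prod n)) (stair_poly t n) \<in> R"
proof -
  interpret unital_subring R by fact
  let ?S = "to_fract ` R" and ?z = "to_fract [:0, 1 :: 'a:]"
  have "unital_subring ?S"
  proof
    show "1 \<in> ?S" by (rule image_eqI[of _ _ 1]) auto
    fix a b assume "a \<in> ?S" "b \<in> ?S"
    then obtain x y where "a = to_fract x" "b = to_fract y" "x \<in> R" "y \<in> R" by blast
    then show "a - b \<in> ?S" "a * b \<in> ?S"
      by (auto intro: image_eqI[of _ _ "x - y"] image_eqI[of _ _ "x * y"])
  qed
  then interpret half_series ?z ?S
    using assms(2) by (intro half_series.intro) auto
  \<comment> \<open>The values \<open>t k\<close> with k >= n may lie outside \<open>R\<close>; they
    are set to 0, which the coefficients below 2n do not see.\<close>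
  define v where "v = tau_series (\<lambda>k. if k < n then to_fract [:t k:] else 0)"
  have "fps_nth v k \<in> ?S" for k
    using t by (auto simp: v_def tau_series_nth simp flip: to_fract_1 to_fract_0)
  moreover have "fps_nth v 0 = 1" by (simp add: v_def tau_series_nth)
  ultimately have "of_nat (A_prod n) * stair n (fps_binomial ?z * v) \<in> ?S"
    by (rule stair_binomial_closed)
  also have "stair n (fps_binomial ?z * v) = to_fract (stair_poly t n)"
    unfolding to_fract_stair_poly
  proof (rule stair_cong)
    fix k assume k: "k < 2 * n"
    have "fps_nth v i = fps_nth (tau_series (\<lambda>k. to_fract [:t k:])) i" if "i \<le> k" for i
      using that k by (auto simp: v_def tau_series_nth)
    then show "fps_nth (fps_binomial ?z * v) k =
        fps_nth (fps_binomial ?z * tau_series (\<lambda>k. to_fract [:t k:])) k"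
      unfolding fps_mult_nth by (intro sum.cong) auto
  qed
  also have "of_nat (A_prod n) * to_fract (stair_poly t n) = to_fract (smult (of_nat (A_prod n)) (stair_poly t n))"
  proof -
    interpret comm_ring_hom "to_fract :: 'a poly \<Rightarrow> _" by (rule comm_ring_hom_to_fract)
    have "smult (of_nat (A_prod n)) (stair_poly t n) = of_nat (A_prod n) * stair_poly t n"
      by (simp add: of_nat_poly)
    then show ?thesis by (simp add: hom_of_nat)
  qed
  finally show ?thesis by auto
qed

section \<open>The solution with the indeterminates as initial values\<close>

lemma unital_subring_laurent_ring: "unital_subring (laurent_ring n)"
  unfolding laurent_ring_def by unfold_locales (auto intro: subring_gen.intros)

lemma indet_nonzero: "indet k \<noteq> 0"
proof -
  have "Poly_Mapping.single x (1 :: rat) \<noteq> 0" for x :: "nat \<Rightarrow>\<^sub>0 nat"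
    by (metis lookup_single_eq lookup_zero zero_neq_one)
  then show ?thesis by (simp add: indet_def Zero_fract_def eq_fract)
qed

theorem corollary2:
  shows "\<exists>Q :: int \<Rightarrow> rat_funs poly.
    Q (- 1) = 1 \<and> Q 0 = 1 \<and>
    (\<forall>n\<ge>0. shift (Q (n + 1)) * Q (n - 1) - Q (n + 1) * shift (Q (n - 1)) = Q n * shift (Q n)) \<and>
    (\<forall>k::nat. k \<ge> 1 \<longrightarrow> poly (Q (int k)) 0 = indet k) \<and>
    (\<forall>n::nat. n \<ge> 1 \<longrightarrow> smult (of_nat (A_prod n)) (Q (int n)) \<in> laurent_ring n)"
proof -
  \<comment> \<open>\<open>q 0\<close> = 1 is the value of Q_0; by truncated subtraction it is also
    the divisor in the recursion for \<open>t 0\<close> and \<open>t 1\<close>.\<close>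
  define q where "q k = (if k = 0 then 1 else indet k)" for k
  have nz: "q k \<noteq> 0" for k by (simp add: q_def indet_nonzero)
  obtain t where t: "\<And>n. stair n (tau_series t) = q n"
    using stair_prescribed[of q] nz by (auto simp: q_def)
  define Q where "Q n = (if n < 0 then 1 else stair_poly t (nat n))" for n :: int
  have Q_nat: "Q (int n) = stair_poly t n" for n by (simp add: Q_def)
  have Q0: "Q 0 = 1" by (simp add: Q_def stair_poly_def)
  have "shift (Q (n + 1)) * Q (n - 1) - Q (n + 1) * shift (Q (n - 1)) = Q n * shift (Q n)"
    if "n \<ge> 0" for n
  proof -
    obtain k where k: "n = int k" using \<open>n \<ge> 0\<close> nonneg_int_cases by blast
    \<comment> \<open>At k = 0 both sides of the middle equation are 1: Q (-1) by definition,
      \<open>stair_poly t 0\<close> as an empty determinant.\<close>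
    have "Q (n + 1) = stair_poly t (k + 1)" "Q (n - 1) = stair_poly t (k - 1)" "Q n = stair_poly t k"
      by (auto simp: Q_def k nat_add_distrib stair_poly_def nat_diff_distrib)
    then show ?thesis
      using stair_poly_burchnall_chaundy[of k t] nz by (simp add: t)
  qed
  moreover have "poly (Q (int k)) 0 = indet k" if "k \<ge> 1" for k
    using that by (simp add: Q_nat stair_poly_0 t q_def)
  moreover have "smult (of_nat (A_prod n)) (Q (int n)) \<in> laurent_ring n" for n
    unfolding Q_nat
  proof (rule stair_poly_closed[OF unital_subring_laurent_ring])
    interpret unital_subring "laurent_ring n" by (rule unital_subring_laurent_ring)
    show "[:0, 1:] \<in> laurent_ring n"
      unfolding laurent_ring_def by (rule subring_gen.gen) simp
    \<comment> \<open>\<open>tau_closed\<close> works in a field, so the ring is first cut down to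
      its constants.\<close>
    let ?C = "{c. [:c:] \<in> laurent_ring n}"
    have C: "unital_subring ?C"
    proof
      show "1 \<in> ?C" using one by (simp add: one_pCons)
    next
      fix a b assume "a \<in> ?C" "b \<in> ?C"
      then show "a - b \<in> ?C" "a * b \<in> ?C"
        using diff[of "[:a:]" "[:b:]"] mult[of "[:a:]" "[:b:]"] by (simp_all add: mult.commute)
    qed
    have "t k \<in> ?C" if "k < n" for k
    proof (rule tau_closed[OF C t nz _ _ that])
      interpret C: unital_subring ?C by (rule C)
      show "q k \<in> ?C" if "k \<le> n" for k
      proof (cases "k = 0")
        case True
        then show ?thesis using C.one by (simp add: q_def)
      next
        case False
        then have "[:indet k:] \<in> laurent_ring n"
          using that unfolding laurent_ring_def by (intro subring_gen.gen) auto
        then show ?thesis using False by (simp add: q_def)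
      qed
      \<comment> \<open>For n = 1, 2 the bound leaves only k = 0 with \<open>q 0\<close> = 1, in
        accordance with nothing being inverted.\<close>
      show "inverse (q k) \<in> ?C" if "k \<le> n - 2" for k
      proof (cases "k = 0")
        case True
        then show ?thesis using C.one by (simp add: q_def)
      next
        case False
        then have "[:inverse (indet k):] \<in> laurent_ring n"
          using that unfolding laurent_ring_def by (intro subring_gen.gen) auto
        then show ?thesis using False by (simp add: q_def)
      qed
    qed
    then show "[:t k:] \<in> laurent_ring n" if "k < n" for k using that by simp
  qed
  moreover have "Q (-1) = 1" by (simp add: Q_def)
  ultimately show ?thesis using Q0 by blast
qed

end
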